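(* Let $\mathcal{R}$ be the class of irrational rotations, let $\Delta$ be a metric space, and let $J:\mathcal{R}\to\Delta$ be a finitely observable isomorphism invariant for $\mathcal{R}$. Define $\widetilde{J}:[0,1)\setminus\mathbb{Q}\to\Delta$ by $\widetilde{J}(\alpha)=J(\mathcal{X}_\alpha)$, where $\mathcal{X}_\alpha$ is the rotation of $[0,1)$ by $\alpha$. Then $\widetilde{J}$ is constant on a set of full Lebesgue measure. In particular, no finitely observable isomorphism invariant on $\mathcal{R}$ is complete.
   Context: For $\alpha\in[0,1)\setminus\mathbb{Q}$, $\mathcal{X}_\alpha=([0,1),\mathcal{B},\lambda,T_\alpha)$, where $\lambda$ is Lebesgue measure and $T_\alpha(x)=x+\alpha \pmod 1$. A partition $\mathcal{P}=(P_1,\dots,P_r)$ of the space of a system $(X,\mathcal{B},\mu,T)$ is a finite ordered collection of pairwise disjoint measurable sets whose union is $X$ up to measure zero; $\mathcal{P}(\omega)$ is the index of the element containing $\omega$. It generates if the $\sigma$-algebra generated by $\{T^n\mathcal{P}\}_{n\in\mathbb{Z}}$ is $\mathcal{B}$ up to measure zero. If $\mathcal{P}$ generates, the process arising from $\mathcal{P}$ is the stationary finite-valued process $x_n(\omega)=\mathcal{P}(T^n\omega)$, $n\in\mathbb{Z}$, with values in $\mathbb{N}$. Every aperiodic ergodic process $(x_n)_{n\in\mathbb{Z}}$ with finitely many values in $\mathbb{N}$ arises in this way from a system that is unique up to isomorphism; write $(x_n)\cong(y_n)$ if the systems determined by the two processes are isomorphic. The class $\mathcal{R}$ of irrational rotations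 is identified with the (saturated, i.e. closed under $\cong$) family of all processes arising from finite generating partitions of systems isomorphic to some $\mathcal{X}_\alpha$, $\alpha\in[0,1)\setminus\mathbb{Q}$. An observation scheme is a metric space $\Delta$ together with functions $s_n:\mathbb{N}^n\to\Delta$, $n\ge 1$. A function $J:\mathcal{C}\to\Delta$ on a family $\mathcal{C}$ of processes is finitely observable if there is an observation scheme $(s_n)$ with values in $\Delta$ such that $s_n(x_1,\dots,x_n)\to J((x_n))$ in probability for every process $(x_n)\in\mathcal{C}$. For a saturated family $\mathcal{C}$, $J:\mathcal{C}\to\Delta$ is an isomorphism invariant if $(x_n)\cong(y_n)$ implies $J((x_n))=J((y_n))$ for all $(x_n),(y_n)\in\mathcal{C}$; one then writes $J(\mathcal{X})$ for the common value of $J$ on all processes arising from generating partitions of $\mathcal{X}$. An invariant $J$ is complete if also $J((x_n))=J((y_n))$ implies $(x_n)\cong(y_n)$ for all $(x_n),(y_n)\in\mathcal{C}$. *)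

theory Defs
  imports "HOL-Analysis.Analysis" "HOL-Probability.Probability"
begin

section \<open>Systems and isomorphism\<close>

definition is_system :: "'a measure \<Rightarrow> ('a \<Rightarrow> 'a) \<Rightarrow> bool" where
  "is_system M T \<longleftrightarrow>
     prob_space M \<and> bij_betw T (space M) (space M) \<and>
     T \<in> measurable M M \<and> inv_into (space M) T \<in> measurable M M \<and>
     distr M M T = M"

text \<open>Isomorphism modulo null sets: a measure preserving equivariant map with an
  almost everywhere inverse. The inverse is then measure preserving and
  equivariant almost everywhere as well.\<close>

definition isomorphic_systems ::
    "'a measure \<Rightarrow> ('a \<Rightarrow> 'a) \<Rightarrow> 'b measure \<Rightarrow> ('b \<Rightarrow> 'b) \<Rightarrow> bool" where
  "isomorphic_systems M T N S \<longleftrightarrow>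
     (\<exists>\<phi>\<in>measurable M N. \<exists>\<psi>\<in>measurable N M.
        distr M N \<phi> = N \<and>
        (AE x in M. \<psi> (\<phi> x) = x) \<and> (AE y in N. \<phi> (\<psi> y) = y) \<and>
        (AE x in M. \<phi> (T x) = S (\<phi> x)))"

definition iter :: "'a measure \<Rightarrow> ('a \<Rightarrow> 'a) \<Rightarrow> int \<Rightarrow> 'a \<Rightarrow> 'a" where
  "iter M T n = (if n \<ge> 0 then T ^^ nat n else inv_into (space M) T ^^ nat (- n))"


section \<open>Partitions and the processes arising from them\<close>

text \<open>The list \<open>P\<close> stands for the ordered partition \<open>(P\<^sub>1, \<dots>, P\<^sub>r)\<close>, so
  \<open>P\<^sub>i\<close> is \<open>P ! (i - 1)\<close>.\<close>

definition finite_partition :: "'a measure \<Rightarrow> 'a set list \<Rightarrow> bool" where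
  "finite_partition M P \<longleftrightarrow>
     set P \<subseteq> sets M \<and> disjoint_family_on (\<lambda>i. P ! i) {..<length P} \<and>
     (AE x in M. x \<in> \<Union> (set P))"

text \<open>Indices run from 1 to \<open>r\<close>; the value 0 only occurs on the null set not
  covered by the partition.\<close>

definition cell_index :: "'a set list \<Rightarrow> 'a \<Rightarrow> nat" where
  "cell_index P x =
     (if \<exists>i<length P. x \<in> P ! i then Suc (LEAST i. i < length P \<and> x \<in> P ! i) else 0)"

definition generates :: "'a measure \<Rightarrow> ('a \<Rightarrow> 'a) \<Rightarrow> 'a set list \<Rightarrow> bool" where
  "generates M T P \<longleftrightarrow>
     (\<forall>A\<in>sets M. \<exists>B\<in>sigma_sets (space M) {iter M T n ` C | n C. C \<in> set P}.
        (A - B) \<union> (B - A) \<in> null_sets M)"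

text \<open>A process is represented by its law on two-sided sequences. This loses
  nothing: isomorphism of processes and convergence in probability of functions of
  \<open>x\<^sub>1, \<dots>, x\<^sub>n\<close> to a constant depend on the law only.\<close>

type_synonym process = "(int \<Rightarrow> nat) measure"

definition paths :: process where
  "paths = PiM UNIV (\<lambda>_. count_space UNIV)"

definition process_law :: "'a measure \<Rightarrow> ('a \<Rightarrow> 'a) \<Rightarrow> 'a set list \<Rightarrow> process" where
  "process_law M T P = distr M paths (\<lambda>\<omega> n. cell_index P (iter M T n \<omega>))"

definition processes_of :: "'a measure \<Rightarrow> ('a \<Rightarrow> 'a) \<Rightarrow> process set" where
  "processes_of M T = {process_law M T P | P. finite_partition M P \<and> generates M T P}"

text \<open>The system determined by a process is the shift on its path space, on which
  the zeroth coordinate is a generating partition.\<close>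

definition shift :: "(int \<Rightarrow> nat) \<Rightarrow> (int \<Rightarrow> nat)" where
  "shift x = (\<lambda>n. x (n + 1))"

definition isomorphic_processes :: "process \<Rightarrow> process \<Rightarrow> bool" (infix "\<cong>\<^sub>p" 50) where
  "\<mu> \<cong>\<^sub>p \<nu> \<longleftrightarrow> isomorphic_systems \<mu> shift \<nu> shift"


section \<open>Finitely observable invariants\<close>

text \<open>An observation scheme \<open>(s\<^sub>n)\<close> is a single function on lists, \<open>s\<^sub>n\<close> being its
  restriction to lists of length \<open>n\<close>.\<close>

definition observes ::
    "process set \<Rightarrow> (nat list \<Rightarrow> 'd::metric_space) \<Rightarrow> (process \<Rightarrow> 'd) \<Rightarrow> bool" where
  "observes \<C> s J \<longleftrightarrow>
     (\<forall>\<mu>\<in>\<C>. \<forall>\<epsilon>>0.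
        (\<lambda>n. measure \<mu> {x \<in> space \<mu>.
            dist (s (map (\<lambda>i. x (int i)) [1..<Suc n])) (J \<mu>) > \<epsilon>})
          \<longlonglongrightarrow> 0)"

definition finitely_observable ::
    "process set \<Rightarrow> (process \<Rightarrow> 'd::metric_space) \<Rightarrow> bool" where
  "finitely_observable \<C> J \<longleftrightarrow> (\<exists>s. observes \<C> s J)"

definition isomorphism_invariant :: "process set \<Rightarrow> (process \<Rightarrow> 'd) \<Rightarrow> bool" where
  "isomorphism_invariant \<C> J \<longleftrightarrow> (\<forall>\<mu>\<in>\<C>. \<forall>\<nu>\<in>\<C>. \<mu> \<cong>\<^sub>p \<nu> \<longrightarrow> J \<mu> = J \<nu>)"

definition complete_invariant :: "process set \<Rightarrow> (process \<Rightarrow> 'd) \<Rightarrow> bool" where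
  "complete_invariant \<C> J \<longleftrightarrow>
     isomorphism_invariant \<C> J \<and> (\<forall>\<mu>\<in>\<C>. \<forall>\<nu>\<in>\<C>. J \<mu> = J \<nu> \<longrightarrow> \<mu> \<cong>\<^sub>p \<nu>)"

definition common_value :: "(process \<Rightarrow> 'd) \<Rightarrow> 'a measure \<Rightarrow> ('a \<Rightarrow> 'a) \<Rightarrow> 'd" where
  "common_value J M T = (THE d. J ` processes_of M T = {d})"


section \<open>Irrational rotations\<close>

definition circle :: "real measure" where
  "circle = restrict_space lborel {0..<1}"

definition rotation :: "real \<Rightarrow> real \<Rightarrow> real" where
  "rotation \<alpha> x = frac (x + \<alpha>)"

text \<open>Systems are taken on the type \<^typ>\<open>real\<close> since a definition cannot quantify
  over types; \<open>processes_of_subset_rotation_processes\<close> below shows that systems on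
  other types contribute nothing more.\<close>

definition rotation_processes :: "process set" ("\<R>") where
  "\<R> = {\<mu>. \<exists>\<alpha>\<in>{0..<1} - \<rat>. \<exists>(M :: real measure) T.
         is_system M T \<and> isomorphic_systems M T circle (rotation \<alpha>) \<and>
         \<mu> \<in> processes_of M T}"

definition rotation_value :: "(process \<Rightarrow> 'd) \<Rightarrow> real \<Rightarrow> 'd" where
  "rotation_value J \<alpha> = common_value J circle (rotation \<alpha>)"


section \<open>The class of rotations does not depend on the carrier type\<close>

lemma is_systemD:
  assumes "is_system M T"
  shows "prob_space M" "bij_betw T (space M) (space M)" "T \<in> measurable M M"
    "inv_into (space M) T \<in> measurable M M" "distr M M T = M"
  using assms by (auto simp: is_system_def)

lemma AE_comp_measure_preserving:
  assumes f: "f \<in> measurable M N" and d: "distr M N f = N" and "AE y in N. Q y"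
  shows "AE x in M. Q (f x)"
proof -
  have "AE y in distr M N f. Q y" unfolding d by fact
  then show ?thesis using AE_distrD[OF f] by blast
qed

lemma measurable_funpow: "f \<in> measurable M M \<Longrightarrow> f ^^ n \<in> measurable M M"
  by (induction n) (auto simp: comp_def intro: measurable_compose)

lemma iter_measurable: "is_system M T \<Longrightarrow> iter M T n \<in> measurable M M"
  by (auto simp: iter_def is_systemD measurable_funpow)

lemma inv_into_measure_preserving:
  assumes "is_system M T"
  shows "distr M M (inv_into (space M) T) = M"
proof -
  note s = is_systemD[OF assms]
  have "distr M M (inv_into (space M) T) = distr (distr M M T) M (inv_into (space M) T)"
    by (simp add: s)
  also have "\<dots> = distr M M (inv_into (space M) T \<circ> T)"
    by (rule distr_distr) (use s in auto)
  also have "\<dots> = distr M M (\<lambda>x. x)"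
    by (rule distr_cong) (use s(2) in \<open>auto simp: bij_betw_def\<close>)
  finally show ?thesis by (simp add: distr_id2)
qed

lemma iter_inverse:
  assumes "is_system M T" "x \<in> space M"
  shows "iter M T n (iter M T (- n) x) = x"
proof -
  let ?V = "inv_into (space M) T"
  have b: "bij_betw T (space M) (space M)" using is_systemD[OF assms(1)] by simp
  have TV: "(T ^^ k) ((?V ^^ k) y) = y \<and> (?V ^^ k) ((T ^^ k) y) = y"
    if "y \<in> space M" for k y
    using that
  proof (induction k arbitrary: y)
    case (Suc k)
    have 1: "?V y \<in> space M" "T y \<in> space M"
      using b Suc.prems by (auto simp: bij_betw_def inv_into_into)
    have 2: "T (?V y) = y" "?V (T y) = y"
      using b Suc.prems by (auto simp: bij_betw_def f_inv_into_f)
    have "(T ^^ Suc k) ((?V ^^ Suc k) y) = T ((T ^^ k) ((?V ^^ k) (?V y)))"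
      by (simp add: funpow_swap1)
    moreover have "(?V ^^ Suc k) ((T ^^ Suc k) y) = ?V ((?V ^^ k) ((T ^^ k) (T y)))"
      by (simp add: funpow_swap1)
    ultimately show ?case using Suc.IH 1 2 by simp
  qed auto
  show ?thesis
    using TV[OF assms(2)] by (auto simp: iter_def)
qed

lemma iter_image:
  assumes s: "is_system M T" and C: "C \<subseteq> space M" and x: "x \<in> space M"
  shows "x \<in> iter M T n ` C \<longleftrightarrow> iter M T (- n) x \<in> C"
proof
  assume "x \<in> iter M T n ` C"
  then obtain c where c: "c \<in> C" "x = iter M T n c" by auto
  have "iter M T (- n) (iter M T (- (- n)) c) = c"
    using iter_inverse[OF s, of c "- n"] c C by auto
  then show "iter M T (- n) x \<in> C" using c by simp
next
  assume "iter M T (- n) x \<in> C"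
  then show "x \<in> iter M T n ` C" using iter_inverse[OF s x, of n] by force
qed

lemma AE_equivariant_funpow:
  assumes f: "f \<in> measurable N N" "distr N N f = N"
    and e: "AE y in N. \<psi> (f y) = g (\<psi> y)"
  shows "AE y in N. \<psi> ((f ^^ n) y) = (g ^^ n) (\<psi> y)"
proof (induction n)
  case (Suc n)
  have "AE y in N. \<psi> ((f ^^ n) (f y)) = (g ^^ n) (\<psi> (f y))"
    using AE_comp_measure_preserving[OF f Suc] .
  with e show ?case by eventually_elim (simp add: funpow_swap1)
qed simp

lemma AE_equivariant_iter:
  assumes sM: "is_system M T" and sN: "is_system N S"
    and \<psi>: "\<psi> \<in> measurable N M"
    and e: "AE y in N. \<psi> (S y) = T (\<psi> y)"
  shows "AE y in N. \<forall>n. \<psi> (iter N S n y) = iter M T n (\<psi> y)"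
proof -
  let ?V = "inv_into (space M) T" and ?W = "inv_into (space N) S"
  note a = is_systemD[OF sM] and b = is_systemD[OF sN]
  have "AE y in N. \<psi> (S (?W y)) = T (\<psi> (?W y))"
    by (rule AE_comp_measure_preserving[OF b(4) inv_into_measure_preserving[OF sN] e])
  moreover have "AE y in N. y \<in> space N" by auto
  ultimately have i: "AE y in N. \<psi> (?W y) = ?V (\<psi> y)"
  proof eventually_elim
    case (elim y)
    have "?W y \<in> space N" using elim measurable_space[OF b(4)] by auto
    then have "\<psi> (?W y) \<in> space M" using measurable_space[OF \<psi>] by auto
    moreover have "S (?W y) = y" using elim b(2) by (auto simp: bij_betw_def f_inv_into_f)
    ultimately show ?case using elim(1) a(2)
      by (metis bij_betw_def inv_into_f_f)
  qed
  have "AE y in N. \<psi> (iter N S n y) = iter M T n (\<psi> y)" for n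
    using AE_equivariant_funpow[OF b(3) b(5) e, of "nat n"]
      AE_equivariant_funpow[OF b(4) inv_into_measure_preserving[OF sN] i, of "nat (- n)"]
    by (simp add: iter_def)
  then show ?thesis by (simp add: AE_all_countable)
qed

lemma cell_index_measurable:
  assumes "finite_partition L R"
  shows "cell_index R \<in> measurable L (count_space UNIV)"
proof -
  have 1: "{x \<in> space L. i < length R \<and> x \<in> R ! i} \<in> sets L" for i
  proof (cases "i < length R")
    case True
    then have "R ! i \<in> sets L" using assms by (auto simp: finite_partition_def)
    moreover from this have "{x \<in> space L. i < length R \<and> x \<in> R ! i} = R ! i"
      using True sets.sets_into_space by blast
    ultimately show ?thesis by simp
  qed simp
  have 2: "{x \<in> space L. \<exists>i<length R. x \<in> R ! i} \<in> sets L"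
    using sets.sets_Collect_countable_Ex[of L "\<lambda>i x. i < length R \<and> x \<in> R ! i", OF 1] .
  have 3: "(\<lambda>x. LEAST i. i < length R \<and> x \<in> R ! i) \<in> measurable L (count_space UNIV)"
    by (rule measurable_Least, rule iffD2[OF pred_def 1])
  have 4: "(\<lambda>x. Suc (LEAST i. i < length R \<and> x \<in> R ! i)) \<in> measurable L (count_space UNIV)"
    by (rule measurable_compose[OF 3]) simp
  show ?thesis
    unfolding cell_index_def by (rule measurable_If[OF 4 _ 2]) simp
qed

lemma path_map_measurable:
  assumes "finite_partition L R" "is_system L V"
  shows "(\<lambda>\<omega> n. cell_index R (iter L V n \<omega>)) \<in> measurable L paths"
  unfolding paths_def
proof (rule measurable_PiM_single')
  show "(\<lambda>\<omega>. cell_index R (iter L V i \<omega>)) \<in> measurable L (count_space UNIV)" for i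
    by (rule measurable_compose[OF iter_measurable[OF assms(2)] cell_index_measurable[OF assms(1)]])
qed auto

lemma processes_of_subset:
  assumes sM: "is_system M T" and sN: "is_system N S" and iso: "isomorphic_systems M T N S"
  shows "processes_of M T \<subseteq> processes_of N S"
proof
  fix \<mu> assume "\<mu> \<in> processes_of M T"
  then obtain P where P: "finite_partition M P" "generates M T P" "\<mu> = process_law M T P"
    by (auto simp: processes_of_def)
  obtain \<phi> \<psi> where \<phi>: "\<phi> \<in> measurable M N" and \<psi>: "\<psi> \<in> measurable N M"
    and d: "distr M N \<phi> = N" and i1: "AE x in M. \<psi> (\<phi> x) = x"
    and i2: "AE y in N. \<phi> (\<psi> y) = y" and e: "AE x in M. \<phi> (T x) = S (\<phi> x)"
    using iso unfolding isomorphic_systems_def by blast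
  note a = is_systemD[OF sM] and b = is_systemD[OF sN]
  have d': "distr N M \<psi> = M"
  proof -
    have "distr N M \<psi> = distr (distr M N \<phi>) M \<psi>" by (simp add: d)
    also have "\<dots> = distr M M (\<psi> \<circ> \<phi>)" by (rule distr_distr[OF \<psi> \<phi>])
    also have "\<dots> = distr M M (\<lambda>x. x)"
    proof (rule distr_cong_AE)
      show "AE x in M. (\<psi> \<circ> \<phi>) x = x" using i1 by simp
    qed (use measurable_comp[OF \<phi> \<psi>] in simp_all)
    finally show ?thesis by (simp add: distr_id2)
  qed
  note mp\<psi> = AE_comp_measure_preserving[OF \<psi> d']
  have "AE y in N. \<psi> (\<phi> (T (\<psi> y))) = T (\<psi> y)"
    by (rule mp\<psi>[OF AE_comp_measure_preserving[OF a(3) a(5) i1]])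
  with mp\<psi>[OF e] i2 have e': "AE y in N. \<psi> (S y) = T (\<psi> y)"
    by eventually_elim metis
  note eq = AE_equivariant_iter[OF sM sN \<psi> e']
  define Q where "Q = map (\<lambda>A. \<psi> -` A \<inter> space N) P"
  have PS: "C \<subseteq> space M" if "C \<in> set P" for C
    using P(1) that sets.sets_into_space unfolding finite_partition_def by blast
  have lenQ: "length Q = length P" by (simp add: Q_def)
  have nthQ: "y \<in> Q ! i \<longleftrightarrow> \<psi> y \<in> P ! i" if "y \<in> space N" "i < length P" for y i
    using that by (simp add: Q_def)
  have idx: "cell_index Q y = cell_index P (\<psi> y)" if "y \<in> space N" for y
  proof -
    have "(\<lambda>i. i < length Q \<and> y \<in> Q ! i) = (\<lambda>i. i < length P \<and> \<psi> y \<in> P ! i)"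
      using nthQ[OF that] lenQ by auto
    then show ?thesis unfolding cell_index_def by metis
  qed
  have "finite_partition N Q"
    unfolding finite_partition_def
  proof (intro conjI)
    show "set Q \<subseteq> sets N"
      using P(1) \<psi> by (auto simp: Q_def finite_partition_def intro: measurable_sets)
    show "disjoint_family_on (\<lambda>i. Q ! i) {..<length Q}"
      using P(1) by (fastforce simp: Q_def finite_partition_def disjoint_family_on_def)
    have "AE y in N. \<psi> y \<in> \<Union> (set P)"
      by (rule mp\<psi>) (use P(1) in \<open>simp add: finite_partition_def\<close>)
    moreover have "AE y in N. y \<in> space N" by auto
    ultimately show "AE y in N. y \<in> \<Union> (set Q)"
      by eventually_elim (auto simp: Q_def)
  qed
  moreover have "generates N S Q"
    unfolding generates_def
  proof
    let ?GP = "{iter M T n ` C | n C. C \<in> set P}" and ?GQ = "{iter N S n ` C | n C. C \<in> set Q}"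
    have GQ: "sigma_sets (space N) ?GQ \<subseteq> sets N"
    proof (rule sets.sigma_sets_subset, safe)
      fix n C assume C: "C \<in> set Q"
      then have Cs: "C \<in> sets N"
        using \<open>finite_partition N Q\<close> by (auto simp: finite_partition_def)
      have "iter N S n ` C = iter N S (- n) -` C \<inter> space N"
        using iter_image[OF sN sets.sets_into_space[OF Cs], of _ n]
          measurable_space[OF iter_measurable[OF sN, of n]] sets.sets_into_space[OF Cs] by blast
      then show "iter N S n ` C \<in> sets N"
        using measurable_sets[OF iter_measurable[OF sN] Cs] by simp
    qed
    have tr: "\<exists>H\<in>sigma_sets (space N) ?GQ. AE y in N. y \<in> H \<longleftrightarrow> \<psi> y \<in> G"
      if "G \<in> sigma_sets (space M) ?GP" for G
      using that
    proof induction
      case (Basic G)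
      then obtain n C where C: "C \<in> set P" "G = iter M T n ` C" by auto
      let ?C = "\<psi> -` C \<inter> space N"
      have "AE y in N. y \<in> iter N S n ` ?C \<longleftrightarrow> \<psi> y \<in> G"
        using eq AE_space
      proof eventually_elim
        case (elim y)
        have "y \<in> iter N S n ` ?C \<longleftrightarrow> iter N S (- n) y \<in> ?C"
          by (rule iter_image[OF sN]) (use elim in auto)
        also have "\<dots> \<longleftrightarrow> \<psi> (iter N S (- n) y) \<in> C"
          using elim measurable_space[OF iter_measurable[OF sN]] by auto
        also have "\<dots> \<longleftrightarrow> iter M T (- n) (\<psi> y) \<in> C" using elim by simp
        also have "\<dots> \<longleftrightarrow> \<psi> y \<in> G"
          using iter_image[OF sM PS[OF C(1)], of "\<psi> y" n] C(2) elim measurable_space[OF \<psi>] by auto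
        finally show ?case .
      qed
      moreover have "iter N S n ` ?C \<in> ?GQ" using C(1) by (auto simp: Q_def)
      ultimately show ?case by blast
    next
      case Empty
      have "{} \<in> sigma_sets (space N) ?GQ" by (rule sigma_sets.Empty)
      then show ?case by force
    next
      case (Compl G)
      then obtain H where H: "H \<in> sigma_sets (space N) ?GQ" "AE y in N. y \<in> H \<longleftrightarrow> \<psi> y \<in> G"
        by blast
      have "AE y in N. y \<in> space N - H \<longleftrightarrow> \<psi> y \<in> space M - G"
        using H(2) AE_space by eventually_elim (use measurable_space[OF \<psi>] in auto)
      then show ?case using sigma_sets.Compl[OF H(1)] by blast
    next
      case (Union G)
      have "\<forall>i. \<exists>H. H \<in> sigma_sets (space N) ?GQ \<and> (AE y in N. y \<in> H \<longleftrightarrow> \<psi> y \<in> G i)"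
        using Union.IH by blast
      from choice[OF this] obtain H where H: "\<And>i. H i \<in> sigma_sets (space N) ?GQ"
        "\<And>i. AE y in N. y \<in> H i \<longleftrightarrow> \<psi> y \<in> G i"
        by blast
      have "AE y in N. \<forall>i::nat. y \<in> H i \<longleftrightarrow> \<psi> y \<in> G i"
        using H(2) by (simp add: AE_all_countable)
      then have "AE y in N. y \<in> (\<Union>i. H i) \<longleftrightarrow> \<psi> y \<in> (\<Union>i. G i)"
        by eventually_elim auto
      then show ?case using sigma_sets.Union[of H, OF H(1)] by blast
    qed
    fix B assume B: "B \<in> sets N"
    have "\<phi> -` B \<inter> space M \<in> sets M" using measurable_sets[OF \<phi> B] .
    then obtain G where G: "G \<in> sigma_sets (space M) ?GP"
      "(\<phi> -` B \<inter> space M - G) \<union> (G - \<phi> -` B \<inter> space M) \<in> null_sets M"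
      using P(2) unfolding generates_def by blast
    have "AE x in M. x \<in> \<phi> -` B \<inter> space M \<longleftrightarrow> x \<in> G"
      using AE_not_in[OF G(2)] by eventually_elim auto
    then have *: "AE y in N. \<psi> y \<in> \<phi> -` B \<inter> space M \<longleftrightarrow> \<psi> y \<in> G" by (rule mp\<psi>)
    obtain H where H: "H \<in> sigma_sets (space N) ?GQ" "AE y in N. y \<in> H \<longleftrightarrow> \<psi> y \<in> G"
      using tr[OF G(1)] by blast
    have HN: "H \<in> sets N" using H(1) GQ by auto
    have "AE y in N. y \<notin> (B - H) \<union> (H - B)"
      using * H(2) i2 AE_space
      by eventually_elim (use measurable_space[OF \<psi>] in auto)
    then have "(B - H) \<union> (H - B) \<in> null_sets N"
      using B HN by (subst AE_iff_null_sets) auto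
    then show "\<exists>H\<in>sigma_sets (space N) ?GQ. (B - H) \<union> (H - B) \<in> null_sets N"
      using H(1) by blast
  qed
  moreover have "\<mu> = process_law N S Q"
  proof -
    have "\<mu> = distr (distr N M \<psi>) paths (\<lambda>\<omega> n. cell_index P (iter M T n \<omega>))"
      by (simp add: d' P(3) process_law_def)
    also have "\<dots> = distr N paths ((\<lambda>\<omega> n. cell_index P (iter M T n \<omega>)) \<circ> \<psi>)"
      by (rule distr_distr[OF path_map_measurable[OF P(1) sM] \<psi>])
    also have "\<dots> = distr N paths (\<lambda>\<omega> n. cell_index Q (iter N S n \<omega>))"
    proof (rule distr_cong_AE)
      show "AE y in N. ((\<lambda>\<omega> n. cell_index P (iter M T n \<omega>)) \<circ> \<psi>) y =
          (\<lambda>n. cell_index Q (iter N S n y))"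
        using eq AE_space
        by eventually_elim (use idx measurable_space[OF iter_measurable[OF sN]] in auto)
    qed (use measurable_comp[OF \<psi> path_map_measurable[OF P(1) sM]]
        path_map_measurable[OF \<open>finite_partition N Q\<close> sN] in auto)
    finally show ?thesis by (simp add: process_law_def)
  qed
  ultimately show "\<mu> \<in> processes_of N S" unfolding processes_of_def by blast
qed

lemma isomorphic_systems_refl:
  "is_system M T \<Longrightarrow> isomorphic_systems M T M T"
  unfolding isomorphic_systems_def
  by (rule bexI[of _ "\<lambda>x. x"], rule bexI[of _ "\<lambda>x. x"]) (simp_all add: distr_id2)

lemma is_system_rotation:
  assumes "\<alpha> \<in> {0..<1}"
  shows "is_system circle (rotation \<alpha>)"
proof -
  have sp: "space circle = {0..<1}" by (simp add: circle_def space_restrict_space)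
  define \<beta> where "\<beta> = frac (- \<alpha>)"
  have r: "rotation \<gamma> \<in> measurable circle circle" for \<gamma>
    unfolding circle_def rotation_def
    by (rule measurable_restrict_space3) (auto simp: frac_lt_1 simp del: frac_eq, simp add: frac_def)
  have rr: "rotation \<beta> (rotation \<alpha> x) = x" "rotation \<alpha> (rotation \<beta> x) = x"
    if "x \<in> {0..<1}" for x
  proof -
    have 1: "frac (frac y + z) = frac (y + z)" "frac (z + frac y) = frac (y + z)" for y z :: real
      by (simp_all add: frac_def algebra_simps floor_diff_of_int flip: of_int_minus of_int_add)
    have x: "frac x = x" using that by (simp add: frac_eq)
    have "rotation \<beta> (rotation \<alpha> x) = frac (- \<alpha> + (x + \<alpha>))"
      unfolding rotation_def \<beta>_def by (simp only: 1) (simp add: add.commute)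
    then show "rotation \<beta> (rotation \<alpha> x) = x" using x by simp
    have "rotation \<alpha> (rotation \<beta> x) = frac (- \<alpha> + x + \<alpha>)"
      unfolding rotation_def \<beta>_def by (simp only: 1)
    then show "rotation \<alpha> (rotation \<beta> x) = x" using x by simp
  qed
  have rs: "rotation \<gamma> x \<in> {0..<1}" for \<gamma> x by (simp add: rotation_def frac_lt_1)
  have bij: "bij_betw (rotation \<alpha>) (space circle) (space circle)"
    by (rule bij_betw_byWitness[where f' = "rotation \<beta>"]) (use rr rs sp in auto)
  have inv: "inv_into (space circle) (rotation \<alpha>) x = rotation \<beta> x" if "x \<in> space circle" for x
    by (rule inv_into_f_eq) (use bij rr rs sp that in \<open>auto simp: bij_betw_def\<close>)
  have "inv_into (space circle) (rotation \<alpha>) \<in> measurable circle circle"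
    using r[of \<beta>] measurable_cong[of circle "inv_into (space circle) (rotation \<alpha>)" "rotation \<beta>"] inv
    by blast
  moreover have "prob_space circle"
    by (rule prob_spaceI) (simp add: sp, simp add: circle_def emeasure_restrict_space)
  moreover have "distr circle circle (rotation \<alpha>) = circle"
  proof (rule measure_eqI)
    fix A assume "A \<in> sets (distr circle circle (rotation \<alpha>))"
    then have Ac: "A \<in> sets circle" by simp
    then have A: "A \<in> sets borel" "A \<subseteq> {0..<1}"
      by (auto simp: circle_def sets_restrict_space_iff)
    let ?A1 = "A \<inter> {\<alpha>..<1}" and ?A2 = "A \<inter> {0..<\<alpha>}"
    have pre: "rotation \<alpha> -` A \<inter> space circle = (+) \<alpha> -` ?A1 \<union> (+) (\<alpha> - 1) -` ?A2" (is "?L = ?R")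
    proof (intro set_eqI)
      fix x
      show "x \<in> ?L \<longleftrightarrow> x \<in> ?R"
      proof (cases "0 \<le> x \<and> x < 1")
        case True
        then have f: "rotation \<alpha> x = (if \<alpha> + x < 1 then \<alpha> + x else \<alpha> + x - 1)"
          using assms by (auto simp: rotation_def frac_unique_iff)
        show ?thesis
          using True assms A(2) unfolding sp
          by (cases "\<alpha> + x < 1") (auto simp: f algebra_simps)
      next
        case False
        then show ?thesis using assms A(2) unfolding sp by auto
      qed
    qed
    have t: "emeasure lborel ((+) c -` B) = emeasure lborel B \<and> (+) c -` B \<in> sets borel"
      if "B \<in> sets borel" for c :: real and B
    proof -
      have "emeasure lborel B = emeasure (distr lborel borel ((+) c)) B"
        by (simp add: lborel_distr_plus)
      also have "\<dots> = emeasure lborel ((+) c -` B)" by (subst emeasure_distr) (use that in auto)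
      moreover have "(+) c -` B \<in> sets borel"
        using measurable_sets[of "(+) c" borel borel B] that by simp
      ultimately show ?thesis by simp
    qed
    have B: "?A1 \<in> sets borel" "?A2 \<in> sets borel" using A by auto
    have "emeasure (distr circle circle (rotation \<alpha>)) A = emeasure circle ?L"
      by (rule emeasure_distr[OF r Ac])
    also have "\<dots> = emeasure lborel ?L"
      unfolding circle_def by (rule emeasure_restrict_space) (auto simp: space_restrict_space)
    also have "\<dots> = emeasure lborel ((+) \<alpha> -` ?A1) + emeasure lborel ((+) (\<alpha> - 1) -` ?A2)"
      unfolding pre
    proof (rule plus_emeasure[symmetric])
      show "(+) \<alpha> -` ?A1 \<in> sets lborel" "(+) (\<alpha> - 1) -` ?A2 \<in> sets lborel"
        using t[OF B(1)] t[OF B(2)] by (simp_all only: sets_lborel)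
      show "(+) \<alpha> -` ?A1 \<inter> (+) (\<alpha> - 1) -` ?A2 = {}" using assms by auto
    qed
    also have "\<dots> = emeasure lborel ?A1 + emeasure lborel ?A2"
      using t[OF B(1)] t[OF B(2)] by (simp only:)
    also have "\<dots> = emeasure lborel (?A1 \<union> ?A2)"
      by (rule plus_emeasure) (use B in auto)
    also have "?A1 \<union> ?A2 = A" using A assms by auto
    also have "emeasure lborel A = emeasure circle A"
      unfolding circle_def by (rule emeasure_restrict_space[symmetric]) (use A in auto)
    finally show "emeasure (distr circle circle (rotation \<alpha>)) A = emeasure circle A" .
  qed simp
  ultimately show ?thesis using bij r by (simp add: is_system_def)
qed

lemma processes_of_subset_rotation_processes:
  assumes "\<alpha> \<in> {0..<1} - \<rat>" "is_system M T" "isomorphic_systems M T circle (rotation \<alpha>)"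
  shows "processes_of M T \<subseteq> \<R>"
proof -
  have r: "is_system circle (rotation \<alpha>)" using assms(1) by (intro is_system_rotation) simp
  have "processes_of circle (rotation \<alpha>) \<subseteq> \<R>"
    using assms(1) r isomorphic_systems_refl[OF r] unfolding rotation_processes_def by blast
  then show ?thesis using processes_of_subset[OF assms(2) r assms(3)] by simp
qed

end

(*
  If 2 b = a mod 1, the doubling map makes the rotation by a a factor of the rotation by b. Given a
  partition of the circle, pull it back along the doubling map and perturb the pullback slightly so
  that it generates the rotation by b; at some large time n the scheme then reads off the invariant of
  the rotation by b. Copying the perturbation along a lift that is equivariant up to a small set gives
  a small perturbation of the given partition whose n-names under the rotation by a look the same. All
  partitions involved refine [0,1/2) and hence generate the rotation by a, so by a Baire category
  argument in the measure algebra one of them shows the invariant of the rotation by b at infinitely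
  many times, and the two values agree. Hence the invariant is unchanged under dyadic translations of
  the angle; as its distance to a fixed point is a measurable function of the angle, it is constant
  almost everywhere. The angles b and b + 1/2 have the same double, but the rotations are not
  isomorphic, since an isomorphism would yield a set that is mapped to its complement by the
  rotation by b.
*)
theory Submission
  imports Defs
begin

section \<open>Rotations of the circle\<close>

text \<open>The unperturbed pullback is invariant under the half turn, so it does not generate the
  rotation by b; its process is one of the rotation by a, and on it the scheme converges to the
  value for a. An asymmetric change, however small, forces the value for b. No measurable lift of
  the circle under doubling is exactly equivariant: its image would be an invariant set of measure
  1/2. Hence lifts are only approximate, and only names of bounded length can be copied. That length
  depends on the perturbation, so a single copy gives no contradiction; category produces one set
  that is caught at infinitely many lengths. Keeping the half circle in every partition makes every
  set admissible, so category runs over the whole measure algebra and not just over generating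
  partitions. The metric space need not be separable. The scheme, however, takes countably many
  values, and those of the invariant are limits of them.\<close>

lemma space_circle [simp]: "space circle = {0..<1}"
  by (simp add: circle_def space_restrict_space)

lemma sets_circle_iff: "A \<in> sets circle \<longleftrightarrow> A \<in> sets borel \<and> A \<subseteq> {0..<1}"
  by (simp add: circle_def sets_restrict_space_iff conj_commute)

lemma emeasure_circle: "A \<in> sets circle \<Longrightarrow> emeasure circle A = emeasure lborel A"
  unfolding sets_circle_iff by (simp add: circle_def emeasure_restrict_space)

lemma measure_circle: "A \<in> sets circle \<Longrightarrow> measure circle A = measure lborel A"
  by (simp add: measure_def emeasure_circle)

lemma Collect_circle_in_sets: "Measurable.pred borel P \<Longrightarrow> {x \<in> {0..<1}. P x} \<in> sets circle"
  by (auto simp: sets_circle_iff)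

lemma measurable_circle_iff:
  "f \<in> measurable M circle \<longleftrightarrow> f \<in> borel_measurable M \<and> f \<in> space M \<rightarrow> {0..<1}"
  unfolding circle_def by (auto simp: measurable_restrict_space2_iff)

lemma borel_measurable_circleI:
  "f \<in> measurable borel N \<Longrightarrow> f \<in> measurable circle N"
  unfolding circle_def by (simp add: measurable_restrict_space1)

lemma prob_space_circle: "prob_space circle"
  by (rule prob_spaceI) (simp, simp add: circle_def emeasure_restrict_space)

interpretation circle: prob_space circle
  by (rule prob_space_circle)

lemma rotation_range [simp]: "0 \<le> rotation a x" "rotation a x < 1"
  by (simp_all add: rotation_def frac_lt_1)

lemma frac_add_frac:
  fixes x y :: real
  shows "frac (frac x + y) = frac (x + y)" "frac (x + frac y) = frac (x + y)"
  by (metis frac_add_simps(1), metis frac_add_simps(2))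

lemma rotation_rotation: "rotation a (rotation b x) = rotation (a + b) x"
  by (simp add: rotation_def frac_add_frac add_ac)

lemma rotation_0: "0 \<le> x \<Longrightarrow> x < 1 \<Longrightarrow> rotation 0 x = x"
  by (simp add: rotation_def frac_eq)

lemma rotation_frac [simp]: "rotation (frac a) x = rotation a x"
  by (simp add: rotation_def frac_add_frac)

lemma rotation_cong: "frac a = frac b \<Longrightarrow> rotation a x = rotation b x"
  by (metis rotation_frac)

lemma rotation_eq_add: "0 \<le> x + a \<Longrightarrow> x + a < 1 \<Longrightarrow> rotation a x = x + a"
  by (simp add: rotation_def frac_eq)

lemma measurable_frac [measurable]: "(frac :: real \<Rightarrow> real) \<in> borel_measurable borel"
  unfolding frac_def[abs_def] by measurable

lemma measurable_rotation_borel [measurable]: "rotation a \<in> borel_measurable borel"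
  unfolding rotation_def[abs_def] by measurable

lemma measurable_rotation: "rotation a \<in> measurable circle circle"
  by (auto simp: measurable_circle_iff intro: borel_measurable_circleI)

lemma distr_rotation: "distr circle circle (rotation a) = circle"
proof -
  have "rotation a = rotation (frac a)" by auto
  moreover have "frac a \<in> {0..<1}" by (simp add: frac_lt_1)
  ultimately show ?thesis using is_system_rotation[of "frac a"] by (simp add: is_system_def)
qed

lemma measure_rotation_vimage:
  assumes "A \<in> sets circle"
  shows "measure circle {x \<in> {0..<1}. rotation a x \<in> A} = measure circle A"
proof -
  have "measure (distr circle circle (rotation a)) A = measure circle (rotation a -` A \<inter> {0..<1})"
    by (subst measure_distr[OF measurable_rotation assms]) simp
  then show ?thesis by (simp add: distr_rotation vimage_def Int_def conj_commute)
qed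

lemma rotation_vimage_in_sets:
  "A \<in> sets circle \<Longrightarrow> {x \<in> {0..<1}. rotation a x \<in> A} \<in> sets circle"
  using measurable_sets[OF measurable_rotation, of A a] by (simp add: vimage_def Int_def conj_commute)

lemma funpow_rotation:
  "0 \<le> x \<Longrightarrow> x < 1 \<Longrightarrow> (rotation a ^^ n) x = rotation (real n * a) x"
  by (induction n) (auto simp: rotation_0 rotation_rotation algebra_simps)

lemma iter_rotation:
  assumes "a \<in> {0..<1}" "0 \<le> x" "x < 1"
  shows "iter circle (rotation a) n x = rotation (of_int n * a) x"
proof (cases "n \<ge> 0")
  case True
  then show ?thesis using assms by (simp add: iter_def funpow_rotation)
next
  case False
  let ?V = "inv_into {0..<1} (rotation a)"
  have bij: "bij_betw (rotation a) {0..<1} {0..<1}"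
    using is_systemD(2)[OF is_system_rotation[OF assms(1)]] by simp
  have V: "?V y = rotation (- a) y" if "0 \<le> y" "y < 1" for y
    by (rule inv_into_f_eq) (use bij that in \<open>auto simp: bij_betw_def rotation_rotation rotation_0\<close>)
  have "(?V ^^ m) x = rotation (- real m * a) x" for m
    by (induction m) (use assms V in \<open>auto simp: rotation_0 rotation_rotation algebra_simps\<close>)
  from this[of "nat (- n)"] show ?thesis using False by (simp add: iter_def)
qed

section \<open>Density of orbits\<close>

lemma rotation_orbit_approaches:
  assumes "a \<notin> \<rat>" "c < d" "0 \<le> c" "d \<le> 1"
  obtains k :: nat where "c < frac (real k * a)" "frac (real k * a) < d"
proof -
  obtain k where "\<bar>frac (real k * a) - (c + d) / 2\<bar> < (d - c) / 2"
    using Kronecker_approx_1_explicit[of a "(c + d) / 2" "(d - c) / 2"] assms by auto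
  then show thesis by (intro that[of k]) (auto simp: abs_less_iff field_simps)
qed

text \<open>Subtract from \<open>x\<close> a multiple of \<open>a\<close> whose fractional part lies
  in (x - d, x): nothing wraps around, and the result lies in (0, d).\<close>

lemma rotation_orbit_hits:
  assumes "a \<notin> \<rat>" "0 < d" "0 \<le> x" "x < 1"
  shows "\<exists>k::nat. rotation (- real k * a) x < d"
proof (cases "x < d")
  case True
  then show ?thesis using assms by (intro exI[of _ 0]) (simp add: rotation_0)
next
  case False
  then obtain k where k: "x - d < frac (real k * a)" "frac (real k * a) < x"
    using rotation_orbit_approaches[of a "x - d" x] assms by auto
  have "rotation (- real k * a) x = rotation (- frac (real k * a)) x"
    by (rule rotation_cong) (metis frac_frac frac_neg_eq_iff minus_mult_left)
  also have "\<dots> = x - frac (real k * a)"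
    by (subst rotation_eq_add) (use k assms(4) frac_ge_0[of "real k * a"] in linarith)+
  finally show ?thesis using k by (intro exI[of _ k]) auto
qed

section \<open>Generating partitions\<close>

text \<open>The backward orbit of every point enters the given arc, so countably many rotations of
  subsets of the arc suffice to build every set.\<close>

lemma rotation_closed_sigma_algebra_full:
  assumes irr: "a \<notin> \<rat>" and sa: "sigma_algebra {0..<1} \<Sigma>"
    and rot: "\<And>C n. C \<in> \<Sigma> \<Longrightarrow> {x \<in> {0..<1}. rotation (of_int n * a) x \<in> C} \<in> \<Sigma>"
    and d: "0 < d" and arc: "\<And>B. B \<in> sets borel \<Longrightarrow> B \<subseteq> {0..<d} \<inter> {0..<1} \<Longrightarrow> B \<in> \<Sigma>"
    and B: "B \<in> sets circle"
  shows "B \<in> \<Sigma>"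
proof -
  interpret sigma_algebra "{0..<1}" \<Sigma> by (rule sa)
  \<comment> \<open>The points of the arc that \<open>k\<close> rotations carry into
    \<open>B\<close>; carried forward, they form the part of \<open>B\<close> whose point
    \<open>k\<close> steps back lies in the arc.\<close>
  define C where "C k = {x \<in> {0..<1}. rotation (real k * a) x \<in> B} \<inter> {0..<d}" for k :: nat
  have "C k \<in> sets circle \<and> C k \<subseteq> {0..<d}" for k
    using rotation_vimage_in_sets[OF B, of "real k * a"] by (auto simp: C_def sets_circle_iff)
  then have C: "C k \<in> \<Sigma>" for k unfolding sets_circle_iff by (meson arc le_inf_iff)
  have R: "{x \<in> {0..<1}. rotation (- real k * a) x \<in> C k} \<in> \<Sigma>" for k
    using rot[OF C[of k], of "- int k"] by simp
  have "B = (\<Union>k. {x \<in> {0..<1}. rotation (- real k * a) x \<in> C k})" (is "B = ?U")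
  proof (intro set_eqI iffI)
    fix x assume x: "x \<in> B"
    then have "0 \<le> x" "x < 1" using B by (auto simp: sets_circle_iff)
    moreover from this obtain k :: nat where "rotation (- real k * a) x < d"
      using rotation_orbit_hits[OF irr d] by blast
    ultimately show "x \<in> ?U" using x by (auto simp: C_def rotation_rotation rotation_0)
  qed (auto simp: C_def rotation_rotation rotation_0)
  also have "\<dots> \<in> \<Sigma>" by (rule countable_nat_UN) (use R in auto)
  finally show ?thesis .
qed

text \<open>An arc [0, t) is an increasing union of arcs with endpoints from the dense set, and the
  arcs [0, t) are the traces of the half-lines that generate the Borel sets.\<close>

lemma borel_subsets_of_arc:
  fixes c :: real
  assumes sa: "sigma_algebra {0..<1} \<Sigma>" and c: "0 \<le> c" "c \<le> 1"
    and dense: "\<And>s t. 0 \<le> s \<Longrightarrow> s < t \<Longrightarrow> t \<le> c \<Longrightarrow> \<exists>u. s < u \<and> u < t \<and> {0..<u} \<in> \<Sigma>"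
    and full: "{0..<c} \<in> \<Sigma>"
    and B: "B \<in> sets borel" "B \<subseteq> {0..<c}"
  shows "B \<in> \<Sigma>"
proof -
  interpret sigma_algebra "{0..<1}" \<Sigma> by (rule sa)
  have arcs: "{0..<t} \<in> \<Sigma>" if "0 \<le> t" "t \<le> c" for t
  proof (cases "t = 0")
    case False
    \<comment> \<open>The endpoint is taken in the last 1/(n+1)-th of [0, t), so the chosen
      endpoints tend to \<open>t\<close> from below.\<close>
    have "\<exists>u. t * (1 - 1 / (real n + 1)) < u \<and> u < t \<and> {0..<u} \<in> \<Sigma>" for n :: nat
      by (rule dense) (use that False in \<open>auto simp: field_simps\<close>)
    then obtain u where u: "\<And>n :: nat. t * (1 - 1 / (real n + 1)) < u n" "\<And>n. u n < t"
        "\<And>n. {0..<u n} \<in> \<Sigma>"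
      by metis
    have "{0..<t} = (\<Union>n. {0..<u n})"
    proof (intro set_eqI iffI)
      fix x assume x: "x \<in> {0..<t}"
      obtain n :: nat where "t / (t - x) < real n" using reals_Archimedean2 by blast
      then have "x \<le> t * (1 - 1 / (real n + 1))" using x by (auto simp: field_simps)
      with u(1)[of n] x show "x \<in> (\<Union>n. {0..<u n})" by (auto intro!: exI[of _ n])
    qed (use u(2) in \<open>force intro: less_trans\<close>)
    also have "\<dots> \<in> \<Sigma>" by (rule countable_nat_UN) (use u in auto)
    finally show ?thesis .
  qed simp
  have "B \<in> sigma_sets UNIV (range (\<lambda>a::real. {..<a}))"
    using B(1) unfolding borel_Iio by (subst (asm) sets_measure_of) auto
  then have "B \<inter> {0..<c} \<in> \<Sigma>"
  proof induction
    case (Basic A)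
    then obtain b where "A = {..<b}" by auto
    then have "A \<inter> {0..<c} = {0..<min (max b 0) c}" by auto
    then show ?case using arcs[of "min (max b 0) c"] c by auto
  next
    case (Compl A)
    have "(UNIV - A) \<inter> {0..<c} = {0..<c} - (A \<inter> {0..<c})" by auto
    then show ?case using Compl full by auto
  next
    case (Union A)
    have "\<Union> (range A) \<inter> {0..<c} = (\<Union>i. A i \<inter> {0..<c})" by auto
    also have "\<dots> \<in> \<Sigma>" by (rule countable_nat_UN) (use Union in auto)
    finally show ?case .
  qed simp
  then show ?thesis using B(2) by (simp add: Int_absorb2)
qed

text \<open>The half circle minus its rotation by u = frac (k a) < 1/2 is exactly the arc [0, u),
  and irrationality makes these endpoints dense.\<close>

lemma half_circle_rotations_full:
  assumes irr: "a \<notin> \<rat>" and sa: "sigma_algebra {0..<1} \<Sigma>"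
    and rot: "\<And>C n. C \<in> \<Sigma> \<Longrightarrow> {x \<in> {0..<1}. rotation (of_int n * a) x \<in> C} \<in> \<Sigma>"
    and half: "{0..<1/2} \<in> \<Sigma>" and B: "B \<in> sets circle"
  shows "B \<in> \<Sigma>"
proof (rule rotation_closed_sigma_algebra_full[OF irr sa rot _ _ B, where d = "1/2"])
  interpret sigma_algebra "{0..<1}" \<Sigma> by (rule sa)
  fix B :: "real set" assume B: "B \<in> sets borel" "B \<subseteq> {0..<1/2} \<inter> {0..<1}"
  show "B \<in> \<Sigma>"
  proof (rule borel_subsets_of_arc[OF sa _ _ _ half B(1)])
    fix s t :: real assume st: "0 \<le> s" "s < t" "t \<le> 1 / 2"
    obtain k :: nat where k: "s < frac (real k * a)" "frac (real k * a) < t"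
      using rotation_orbit_approaches[OF irr st(2)] st by auto
    let ?u = "frac (real k * a)"
    have *: "rotation (of_int (- int k) * a) x = rotation (- ?u) x" for x
      by (rule rotation_cong) (metis frac_frac frac_neg_eq_iff minus_mult_left of_int_minus of_int_of_nat_eq)
    \<comment> \<open>Points below \<open>?u\<close> wrap around into [1 - u, 1), which misses the
      half circle because u < 1/2.\<close>
    have "rotation (- ?u) x = x - ?u + 1" if "0 \<le> x" "x < ?u" for x
    proof -
      have "rotation (- ?u) x = rotation (1 - ?u) x" by (rule rotation_cong) (use frac_1_eq[of "- ?u"] in \<open>simp add: add.commute\<close>)
      also have "\<dots> = x + (1 - ?u)" by (rule rotation_eq_add) (use that k st in auto)
      finally show ?thesis by simp
    qed
    moreover have "rotation (- ?u) x = x - ?u" if "?u \<le> x" "x < 1" for x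
      by (subst rotation_eq_add) (use that k st in auto)
    ultimately have "{0..<?u} = {0..<1/2} - {x \<in> {0..<1}. rotation (- ?u) x \<in> {0..<1/2}}"
      using k st by (force simp: not_less)
    also have "\<dots> \<in> \<Sigma>"
      using half rot[OF half, of "- int k"] unfolding * by blast
    finally show "\<exists>u. s < u \<and> u < t \<and> {0..<u} \<in> \<Sigma>" using k by blast
  qed (use B in auto)
qed auto

section \<open>Orbit names\<close>

text \<open>For the rotation by a, \<open>F\<close> stays fixed and secures generation, while
  \<open>A\<close> is an arbitrary measurable set; the partitions are thus parametrized by the
  measure algebra.\<close>

definition cells :: "real set \<Rightarrow> real set \<Rightarrow> real set list" where
  "cells F A = [F \<inter> A, F - A, A - F, {0..<1} - (F \<union> A)]"

definition cell_code :: "real set \<Rightarrow> real set \<Rightarrow> real \<Rightarrow> nat" where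
  "cell_code F A x = (if x \<in> F then if x \<in> A then 1 else 2 else if x \<in> A then 3 else 4)"

text \<open>Times run from 1 to \<open>n\<close>, as in \<open>observes\<close>.\<close>

definition orbit_name :: "real \<Rightarrow> real set \<Rightarrow> real set \<Rightarrow> nat \<Rightarrow> real \<Rightarrow> nat list" where
  "orbit_name a F A n x = map (\<lambda>i. cell_code F A (rotation (real i * a) x)) [1..<Suc n]"

lemma cell_index_cells:
  assumes "x \<in> {0..<1}"
  shows "cell_index (cells F A) x = cell_code F A x"
proof -
  have *: "(i < length (cells F A) \<and> x \<in> cells F A ! i) \<longleftrightarrow> i = cell_code F A x - 1" for i
    using assms by (auto simp: cells_def cell_code_def nth_Cons split: nat.splits)
  show ?thesis unfolding cell_index_def * by (auto simp: cell_code_def Least_equality)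
qed

lemma finite_partition_cells:
  assumes "F \<in> sets circle" "A \<in> sets circle"
  shows "finite_partition circle (cells F A)"
  unfolding finite_partition_def
proof (intro conjI)
  show "set (cells F A) \<subseteq> sets circle"
    using assms sets.compl_sets[OF sets.Un[OF assms]] by (auto simp: cells_def)
  show "disjoint_family_on ((!) (cells F A)) {..<length (cells F A)}"
    by (auto simp: cells_def disjoint_family_on_def nth_Cons split: nat.splits)
  show "AE x in circle. x \<in> \<Union> (set (cells F A))"
    by (rule AE_I2) (auto simp: cells_def)
qed

text \<open>The translates of the cells generate a sigma-algebra that is closed under the rotation
  and contains \<open>F\<close> and \<open>A\<close> as unions of cells, so only abstract
  sigma-algebras of this kind have to be treated. Generation comes out exactly, without null
  sets.\<close>

lemma generates_cellsI:
  assumes a: "a \<in> {0..<1}" and FA: "F \<in> sets circle" "A \<in> sets circle"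
    and full: "\<And>\<Sigma> B. sigma_algebra {0..<1} \<Sigma> \<Longrightarrow>
      (\<And>C n. C \<in> \<Sigma> \<Longrightarrow> {x \<in> {0..<1}. rotation (of_int n * a) x \<in> C} \<in> \<Sigma>) \<Longrightarrow>
      F \<in> \<Sigma> \<Longrightarrow> A \<in> \<Sigma> \<Longrightarrow> B \<in> sets circle \<Longrightarrow> B \<in> \<Sigma>"
  shows "generates circle (rotation a) (cells F A)"
proof -
  let ?G = "{iter circle (rotation a) n ` C | n C. C \<in> set (cells F A)}"
  define \<Sigma> where "\<Sigma> = sigma_sets {0..<1} ?G"
  note sys = is_system_rotation[OF a]
  have sub: "C \<subseteq> {0..<1}" if "C \<in> set (cells F A)" for C
    using that FA by (auto simp: cells_def sets_circle_iff)
  have im: "iter circle (rotation a) n ` C = {x \<in> {0..<1}. rotation (of_int (- n) * a) x \<in> C}"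
    if "C \<subseteq> {0..<1}" for n C
  proof -
    have "iter circle (rotation a) n ` C \<subseteq> {0..<1}"
      using that measurable_space[OF iter_measurable[OF sys, of n]] by fastforce
    moreover have "x \<in> iter circle (rotation a) n ` C \<longleftrightarrow> rotation (of_int (- n) * a) x \<in> C"
      if "x \<in> {0..<1}" for x
      using iter_image[OF sys, of C x n] \<open>C \<subseteq> {0..<1}\<close> that iter_rotation[OF a, of x "- n"] by simp
    ultimately show ?thesis by blast
  qed
  have "?G \<subseteq> Pow {0..<1}"
  proof
    fix D assume "D \<in> ?G"
    then obtain n C where C: "C \<in> set (cells F A)" and D: "D = iter circle (rotation a) n ` C"
      by blast
    show "D \<in> Pow {0..<1}" unfolding D im[OF sub[OF C]] by auto
  qed
  then have sa: "sigma_algebra {0..<1} \<Sigma>"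
    unfolding \<Sigma>_def by (rule sigma_algebra_sigma_sets)
  interpret sigma_algebra "{0..<1}" \<Sigma> by (rule sa)
  have rot: "{x \<in> {0..<1}. rotation (of_int m * a) x \<in> D} \<in> \<Sigma>" if "D \<in> \<Sigma>" for D m
    using that unfolding \<Sigma>_def
  proof induction
    case (Basic D)
    then obtain n C where C: "C \<in> set (cells F A)" "D = iter circle (rotation a) n ` C" by auto
    have "{x \<in> {0..<1}. rotation (of_int m * a) x \<in> D} = iter circle (rotation a) (n - m) ` C"
      unfolding C(2) im[OF sub[OF C(1)]] by (auto simp: rotation_rotation algebra_simps)
    then show ?case using C(1) by (auto intro: sigma_sets.Basic)
  next
    case Empty
    show ?case using sigma_sets.Empty by simp
  next
    case (Compl D)
    have "{x \<in> {0..<1}. rotation (of_int m * a) x \<in> {0..<1} - D} =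
        {0..<1} - {x \<in> {0..<1}. rotation (of_int m * a) x \<in> D}" by auto
    then show ?case using sigma_sets.Compl[OF Compl.IH] by simp
  next
    case (Union D)
    have "{x \<in> {0..<1}. rotation (of_int m * a) x \<in> (\<Union>i. D i)} =
        (\<Union>i. {x \<in> {0..<1}. rotation (of_int m * a) x \<in> D i})" by auto
    then show ?case using sigma_sets.Union[OF Union.IH] by simp
  qed
  have cell: "C \<in> \<Sigma>" if "C \<in> set (cells F A)" for C
  proof -
    have "iter circle (rotation a) 0 ` C = C" by (simp add: iter_def)
    then have "C \<in> ?G" using that by (metis (mono_tags, lifting) mem_Collect_eq)
    then show ?thesis unfolding \<Sigma>_def by (rule sigma_sets.Basic)
  qed
  have "(F \<inter> A) \<union> (F - A) \<in> \<Sigma>" "(F \<inter> A) \<union> (A - F) \<in> \<Sigma>"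
    by (intro Un cell; simp add: cells_def)+
  moreover have "(F \<inter> A) \<union> (F - A) = F" "(F \<inter> A) \<union> (A - F) = A" by auto
  ultimately have "sets circle \<subseteq> \<Sigma>" using full[OF sa rot] by auto
  then show ?thesis unfolding generates_def \<Sigma>_def by (auto intro!: bexI)
qed

lemma half_circle_in_sets: "{0..<1/2} \<in> sets circle"
  by (auto simp: sets_circle_iff)

lemma generates_half_circle:
  assumes "a \<in> {0..<1} - \<rat>" "A \<in> sets circle"
  shows "generates circle (rotation a) (cells {0..<1/2} A)"
  using assms by (intro generates_cellsI half_circle_in_sets) (auto intro: half_circle_rotations_full)

text \<open>A set that is invariant under the half turn is the preimage of its image under the
  doubling map, so a short arc is needed to separate the two points of a fibre.\<close>

lemma generates_doubling:
  assumes b: "b \<in> {0..<1} - \<rat>" and A: "A \<in> sets circle" and d: "0 < d" "d \<le> 1/2"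
  shows "generates circle (rotation b)
    (cells {x \<in> {0..<1}. frac (2 * x) < 1/2} {x \<in> {0..<1}. frac (2 * x) \<in> A \<longleftrightarrow> \<not> x < d})"
    (is "generates _ _ (cells ?F ?Q)")
proof (rule generates_cellsI)
  have D: "{x \<in> {0..<1}. frac (2 * x) \<in> C} \<in> sets circle" if "C \<in> sets circle" for C
    using that by (auto simp: sets_circle_iff)
  show "?F \<in> sets circle" by (rule Collect_circle_in_sets) measurable
  show Q: "?Q \<in> sets circle"
    using A by (intro Collect_circle_in_sets) (auto simp: sets_circle_iff)
  fix \<Sigma> B
  assume sa: "sigma_algebra {0..<1} \<Sigma>"
    and rot: "\<And>C n. C \<in> \<Sigma> \<Longrightarrow> {x \<in> {0..<1}. rotation (of_int n * b) x \<in> C} \<in> \<Sigma>"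
    and F\<Sigma>: "?F \<in> \<Sigma>" and Q\<Sigma>: "?Q \<in> \<Sigma>" and B: "B \<in> sets circle"
  interpret sigma_algebra "{0..<1}" \<Sigma> by (rule sa)
  \<comment> \<open>The sets whose pullback under doubling lies in \<open>\<Sigma>\<close>. They are
    closed under rotation by 2b and include the half circle, so the pullback of every Borel set is
    available in \<open>\<Sigma>\<close>.\<close>
  define \<Sigma>' where "\<Sigma>' = {C. C \<subseteq> {0..<1} \<and> {x \<in> {0..<1}. frac (2 * x) \<in> C} \<in> \<Sigma>}"
  have sa': "sigma_algebra {0..<1} \<Sigma>'"
    unfolding sigma_algebra_iff2
  proof (intro conjI ballI allI impI)
    show "\<Sigma>' \<subseteq> Pow {0..<1}" "{} \<in> \<Sigma>'" by (auto simp: \<Sigma>'_def)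
    fix C assume C: "C \<in> \<Sigma>'"
    have "{x \<in> {0..<1}. frac (2 * x) \<in> {0..<1} - C} = {0..<1} - {x \<in> {0..<1}. frac (2 * x) \<in> C}"
      by (auto simp: frac_lt_1)
    then show "{0..<1} - C \<in> \<Sigma>'" using C by (auto simp: \<Sigma>'_def)
  next
    fix C :: "nat \<Rightarrow> real set" assume C: "range C \<subseteq> \<Sigma>'"
    have "{x \<in> {0..<1}. frac (2 * x) \<in> (\<Union>i. C i)} = (\<Union>i. {x \<in> {0..<1}. frac (2 * x) \<in> C i})"
      by auto
    also have "\<dots> \<in> \<Sigma>" by (rule countable_nat_UN) (use C in \<open>auto simp: \<Sigma>'_def\<close>)
    finally show "\<Union> (range C) \<in> \<Sigma>'" using C by (auto simp: \<Sigma>'_def)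
  qed
  have irr: "2 * b \<notin> \<rat>"
  proof
    assume "2 * b \<in> \<rat>"
    then have "2 * b / 2 \<in> \<rat>" by (intro Rats_divide) auto
    then show False using b by simp
  qed
  have double: "C \<in> \<Sigma>'" if "C \<in> sets circle" for C
  proof (rule half_circle_rotations_full[OF irr sa' _ _ that])
    fix C n assume C: "C \<in> \<Sigma>'"
    have "frac (2 * rotation (of_int n * b) x) = rotation (of_int n * (2 * b)) (frac (2 * x))" for x
    proof -
      have "frac (2 * frac y) = frac (2 * y)" for y :: real
        by (metis frac_add_frac mult_2)
      then show ?thesis by (simp add: rotation_def frac_add_frac distrib_left mult.left_commute)
    qed
    then have "{x \<in> {0..<1}. frac (2 * x) \<in> {x \<in> {0..<1}. rotation (of_int n * (2 * b)) x \<in> C}} =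
       {x \<in> {0..<1}. rotation (of_int n * b) x \<in> {x \<in> {0..<1}. frac (2 * x) \<in> C}}"
      by (auto simp: frac_lt_1)
    then show "{x \<in> {0..<1}. rotation (of_int n * (2 * b)) x \<in> C} \<in> \<Sigma>'"
      using C rot[of "{x \<in> {0..<1}. frac (2 * x) \<in> C}" n] by (auto simp: \<Sigma>'_def)
  next
    show "{0..<1/2} \<in> \<Sigma>'" using F\<Sigma> by (auto simp: \<Sigma>'_def frac_lt_1)
  qed
  \<comment> \<open>\<open>?Q\<close> differs from the pullback of \<open>A\<close> exactly on the
    arc, so the arc can be extracted once that pullback is available.\<close>
  have "{0..<d} = (?Q - {x \<in> {0..<1}. frac (2 * x) \<in> A}) \<union> ({x \<in> {0..<1}. frac (2 * x) \<in> A} - ?Q)"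
    using d by auto
  also have "\<dots> \<in> \<Sigma>"
    using Q\<Sigma> double[OF A] unfolding \<Sigma>'_def by blast
  finally have arc: "{0..<d} \<in> \<Sigma>" .
  show "B \<in> \<Sigma>"
  proof (rule rotation_closed_sigma_algebra_full[OF _ sa rot d(1) _ B])
    fix B :: "real set" assume B: "B \<in> sets borel" "B \<subseteq> {0..<d} \<inter> {0..<1}"
    \<comment> \<open>Doubling is injective on [0, d) as d \<le> 1/2, so a subset of the arc is the
      arc cut with the pullback of its double.\<close>
    let ?C = "{y \<in> {0..<1}. y / 2 \<in> B}"
    have "?C \<in> sets circle" by (intro Collect_circle_in_sets pred_sets2[OF B(1)]) measurable
    then have "{0..<d} \<inter> {x \<in> {0..<1}. frac (2 * x) \<in> ?C} \<in> \<Sigma>"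
      using arc double unfolding \<Sigma>'_def by blast
    moreover have "frac (2 * x) = 2 * x" if "0 \<le> x" "x < d" for x
      using that d by (auto simp: frac_eq)
    then have "{0..<d} \<inter> {x \<in> {0..<1}. frac (2 * x) \<in> ?C} = B"
      using B(2) d by (auto simp: frac_lt_1)
    ultimately show "B \<in> \<Sigma>" by simp
  qed (use b in auto)
qed (use b in auto)

section \<open>Processes of a rotation\<close>

text \<open>The path map of \<open>process_law\<close> in closed form. Being a formula on all reals,
  unlike \<open>iter\<close>, it commutes with the shift without exceptions.\<close>

definition itinerary :: "real \<Rightarrow> real set list \<Rightarrow> real \<Rightarrow> int \<Rightarrow> nat" where
  "itinerary a P x = (\<lambda>n. cell_index P (rotation (of_int n * a) x))"

lemma shift_itinerary: "shift (itinerary a P x) = itinerary a P (rotation a x)"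
  by (simp add: shift_def itinerary_def rotation_rotation algebra_simps)

lemma iter_itinerary:
  "a \<in> {0..<1} \<Longrightarrow> x \<in> {0..<1} \<Longrightarrow>
    (\<lambda>n. cell_index P (iter circle (rotation a) n x)) = itinerary a P x"
  by (simp add: itinerary_def iter_rotation)

lemma measurable_itinerary:
  assumes "a \<in> {0..<1}" "finite_partition circle P"
  shows "itinerary a P \<in> measurable circle paths"
  using path_map_measurable[OF assms(2) is_system_rotation[OF assms(1)]] iter_itinerary[OF assms(1)]
  by (subst measurable_cong[of _ _ "\<lambda>x n. cell_index P (iter circle (rotation a) n x)"]) auto

lemma process_law_rotation:
  assumes "a \<in> {0..<1}"
  shows "process_law circle (rotation a) P = distr circle paths (itinerary a P)"
  unfolding process_law_def by (rule distr_cong) (use iter_itinerary[OF assms] in auto)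

lemma AE_process_lawI:
  assumes "a \<in> {0..<1}" "finite_partition circle P" "Measurable.pred paths Q"
    and "AE x in circle. Q (itinerary a P x)"
  shows "AE \<omega> in process_law circle (rotation a) P. Q \<omega>"
  unfolding process_law_rotation[OF assms(1)]
  using AE_distr_iff[OF measurable_itinerary[OF assms(1,2)], of Q] assms(3,4) by (simp add: pred_def)

section \<open>Recovering points from itineraries\<close>

lemma cell_index_eq_Suc_iff:
  assumes P: "finite_partition M P" and i: "i < length P"
  shows "cell_index P y = Suc i \<longleftrightarrow> y \<in> P ! i"
proof
  assume idx: "cell_index P y = Suc i"
  then have ex: "\<exists>j. j < length P \<and> y \<in> P ! j"
    unfolding cell_index_def by (metis nat.distinct(1))
  then have "(LEAST j. j < length P \<and> y \<in> P ! j) = i"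
    using idx unfolding cell_index_def by simp
  then show "y \<in> P ! i" using LeastI_ex[OF ex] by simp
next
  assume y: "y \<in> P ! i"
  have "(LEAST j. j < length P \<and> y \<in> P ! j) = i"
  proof (rule Least_equality)
    fix j assume j: "j < length P \<and> y \<in> P ! j"
    have "P ! i \<inter> P ! j = {}" if "i \<noteq> j"
      using P that i j unfolding finite_partition_def disjoint_family_on_def by simp
    then show "i \<le> j" using y j by force
  qed (use i y in simp)
  then show "cell_index P y = Suc i" using i y unfolding cell_index_def by auto
qed

text \<open>Generation says that the sigma-algebra of the itinerary exhausts the Borel sets up to
  null sets. So every arc [0, q) can be read off the path almost surely, and \<open>x\<close> is the
  infimum of the rationals q with x < q.\<close>

lemma generates_left_inverse:
  assumes a: "a \<in> {0..<1}" and P: "finite_partition circle P" "generates circle (rotation a) P"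
  obtains G where "G \<in> measurable paths circle" "AE x in circle. G (itinerary a P x) = x"
proof -
  note sys = is_system_rotation[OF a]
  let ?S = "sigma_sets {0..<1} {iter circle (rotation a) n ` C | n C. C \<in> set P}"
  \<comment> \<open>Sets built from translated cells are exact preimages under the itinerary; null
    sets enter only afterwards.\<close>
  have factor: "\<exists>D\<in>sets paths. \<forall>x\<in>{0..<1}. x \<in> B \<longleftrightarrow> itinerary a P x \<in> D" if "B \<in> ?S" for B
    using that
  proof induction
    case (Basic B)
    then obtain n C where C: "C \<in> set P" "B = iter circle (rotation a) n ` C" by auto
    then obtain i where i: "i < length P" "C = P ! i" by (auto simp: in_set_conv_nth)
    have Csub: "C \<subseteq> {0..<1}"
      using P(1) C(1) unfolding finite_partition_def sets_circle_iff subset_iff by blast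
    \<comment> \<open>A point of the n-th image of a cell shows that cell at time -n; cell values
      start at 1.\<close>
    have "x \<in> B \<longleftrightarrow> itinerary a P x (- n) = Suc i" if "x \<in> {0..<1}" for x
      using iter_image[OF sys, of C x n] Csub that C(2) a cell_index_eq_Suc_iff[OF P(1) i(1)] i(2)
      by (simp add: iter_rotation itinerary_def)
    moreover have "(\<lambda>\<omega>. \<omega> (- n)) -` {Suc i} \<inter> space paths \<in> sets paths"
      unfolding paths_def by (rule measurable_sets[OF measurable_component_singleton]) auto
    moreover have "space paths = UNIV" by (simp add: paths_def space_PiM)
    ultimately show ?case
      by (intro bexI[of _ "(\<lambda>\<omega>. \<omega> (- n)) -` {Suc i} \<inter> space paths"]) auto
  next
    case Empty
    show ?case by (intro bexI[of _ "{}"]) auto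
  next
    case (Compl B)
    then obtain D where D: "D \<in> sets paths" "\<forall>x\<in>{0..<1}. x \<in> B \<longleftrightarrow> itinerary a P x \<in> D" by blast
    then show ?case
      using measurable_space[OF measurable_itinerary[OF a P(1)]]
      by (intro bexI[of _ "space paths - D"]) auto
  next
    case (Union B)
    then obtain D where "\<And>i. D i \<in> sets paths"
      "\<And>i. \<forall>x\<in>{0..<1}. x \<in> B i \<longleftrightarrow> itinerary a P x \<in> D i" by metis
    then show ?case by (intro bexI[of _ "\<Union>i::nat. D i"]) auto
  qed
  have "\<exists>D\<in>sets paths. AE x in circle. x < q \<longleftrightarrow> itinerary a P x \<in> D" for q :: real
  proof -
    have "{x \<in> {0..<1}. x < q} \<in> sets circle" by (rule Collect_circle_in_sets) measurable
    then obtain B where B: "B \<in> ?S"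
      "({x \<in> {0..<1}. x < q} - B) \<union> (B - {x \<in> {0..<1}. x < q}) \<in> null_sets circle"
      using P(2) unfolding generates_def space_circle by blast
    obtain D where D: "D \<in> sets paths" "\<forall>x\<in>{0..<1}. x \<in> B \<longleftrightarrow> itinerary a P x \<in> D"
      using factor[OF B(1)] by blast
    have "AE x in circle. x < q \<longleftrightarrow> itinerary a P x \<in> D"
      using AE_not_in[OF B(2)] AE_space
    proof eventually_elim
      case (elim x)
      then have "x \<in> {0..<1}" by simp
      with D(2) elim(1) show ?case by blast
    qed
    then show ?thesis using D by blast
  qed
  then have "\<forall>q. \<exists>D. D \<in> sets paths \<and> (AE x in circle. x < q \<longleftrightarrow> itinerary a P x \<in> D)" by blast
  from choice[OF this] obtain D where D: "\<And>q. D q \<in> sets paths"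
    "\<And>q. AE x in circle. x < q \<longleftrightarrow> itinerary a P x \<in> D q" by blast
  let ?I = "{q \<in> \<rat>. 0 \<le> q \<and> q \<le> (1::real)}"
  have cI: "countable ?I" by (rule countable_subset[OF _ countable_rat]) auto
  \<comment> \<open>The default 1 is neutral for the infimum, since q ranges over rationals in
    [0, 1].\<close>
  define g where "g \<omega> = (INF q\<in>?I. if \<omega> \<in> D q then q else 1)" for \<omega>
  have g: "g \<in> borel_measurable paths"
    unfolding g_def
  proof (rule borel_measurable_cINF[OF cI])
    show "(\<lambda>\<omega>. if \<omega> \<in> D q then q else 1) \<in> borel_measurable paths" for q
      using D(1)[of q] by measurable
    show "bdd_below ((\<lambda>q. if \<omega> \<in> D q then q else 1) ` ?I)" for \<omega>
      by (rule bdd_belowI2[of _ 0]) auto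
  qed
  have "AE x in circle. \<forall>q\<in>?I. x < q \<longleftrightarrow> itinerary a P x \<in> D q"
    using D(2) by (subst AE_ball_countable[OF cI]) blast
  \<comment> \<open>Taking \<open>frac\<close> changes nothing on paths that code a point and forces
    all other values into [0, 1).\<close>
  then have inv: "AE x in circle. frac (g (itinerary a P x)) = x"
    using AE_space
  proof eventually_elim
    case (elim x)
    then have x: "0 \<le> x" "x < 1" by auto
    have "g (itinerary a P x) = (INF q\<in>?I. if x < q then q else 1)"
      unfolding g_def by (rule INF_cong) (use elim(1) in auto)
    also have "\<dots> = x"
    proof (rule antisym)
      have bdd: "bdd_below ((\<lambda>q. if x < q then q else 1) ` ?I)"
        by (rule bdd_belowI2[of _ 0]) auto
      show "(INF q\<in>?I. if x < q then q else 1) \<le> x"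
      proof (rule dense_ge_bounded[of x 1])
        fix r assume "x < r" "r < 1"
        then obtain q where "q \<in> \<rat>" "x < q" "q < r" using Rats_dense_in_real by blast
        then show "(INF q\<in>?I. if x < q then q else 1) \<le> r"
          using x \<open>r < 1\<close> by (intro cINF_lower2[OF bdd, of q]) auto
      qed (use x in auto)
      show "x \<le> (INF q\<in>?I. if x < q then q else 1)"
        by (rule cINF_greatest) (use x in \<open>auto intro: exI[of _ 0]\<close>)
    qed
    finally show ?case using x by (simp add: frac_eq)
  qed
  show thesis
  proof (rule that)
    show "(\<lambda>\<omega>. frac (g \<omega>)) \<in> measurable paths circle"
      using measurable_compose[OF g measurable_frac] by (auto simp: measurable_circle_iff frac_lt_1)
  qed (rule inv)
qed

section \<open>Isomorphisms between processes of rotations\<close>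

lemma space_paths [simp]: "space paths = UNIV"
  by (simp add: paths_def space_PiM)

lemma measurable_coordinate: "(\<lambda>\<omega>. \<omega> n) \<in> measurable paths (count_space UNIV)"
  unfolding paths_def by (rule measurable_component_singleton) simp

lemma measurable_shift: "shift \<in> measurable paths paths"
  unfolding shift_def paths_def
  by (rule measurable_PiM_single') (use measurable_coordinate in \<open>auto simp: paths_def\<close>)

text \<open>There are countably many coordinates with countably many values, so equality of paths is
  a countable condition. This is what allows almost sure identities to be transferred from the
  circle to path space.\<close>

lemma pred_eq_paths:
  assumes f: "f \<in> measurable M paths" and g: "g \<in> measurable M paths"
  shows "Measurable.pred M (\<lambda>x. f x = g x)"
proof -
  note fn = measurable_compose[OF f measurable_coordinate]
    and gn = measurable_compose[OF g measurable_coordinate]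
  have "Measurable.pred M (\<lambda>x. f x n = g x n)" for n
    by (rule measurable_compose_countable[OF _ gn[of n], of "\<lambda>c x. f x n = c"])
       (rule pred_count_space_const1[OF fn])
  then have "Measurable.pred M (\<lambda>x. \<forall>n. f x n = g x n)" by (rule pred_intros_countable)
  then show ?thesis by (simp add: fun_eq_iff)
qed

lemma sets_process_law [simp, measurable_cong]: "sets (process_law M T P) = sets paths"
  by (simp add: process_law_def)

lemma space_process_law [simp]: "space (process_law M T P) = UNIV"
  by (simp add: process_law_def)

text \<open>Decode the point from a path of one process and record its itinerary through the other
  partition.\<close>

lemma isomorphic_processes_same_rotation:
  assumes a: "a \<in> {0..<1}" and P: "finite_partition circle P" "generates circle (rotation a) P"
    and Q: "finite_partition circle Q" "generates circle (rotation a) Q"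
  shows "process_law circle (rotation a) P \<cong>\<^sub>p process_law circle (rotation a) Q"
proof -
  obtain F where F: "F \<in> measurable paths circle" "AE x in circle. F (itinerary a P x) = x"
    using generates_left_inverse[OF a P] by blast
  obtain G where G: "G \<in> measurable paths circle" "AE x in circle. G (itinerary a Q x) = x"
    using generates_left_inverse[OF a Q] by blast
  note mP = measurable_itinerary[OF a P(1)] and mQ = measurable_itinerary[OF a Q(1)]
  let ?\<mu> = "process_law circle (rotation a) P" and ?\<nu> = "process_law circle (rotation a) Q"
  note \<mu> = process_law_rotation[OF a, of P] and \<nu> = process_law_rotation[OF a, of Q]
  define \<phi> \<psi> where "\<phi> \<omega> = itinerary a Q (F \<omega>)" and "\<psi> \<omega> = itinerary a P (G \<omega>)" for \<omega>
  have \<phi>: "\<phi> \<in> measurable paths paths" and \<psi>: "\<psi> \<in> measurable paths paths"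
    unfolding \<phi>_def[abs_def] \<psi>_def[abs_def]
    using measurable_compose[OF F(1) mQ] measurable_compose[OF G(1) mP] by auto
  have "distr ?\<mu> ?\<nu> \<phi> = ?\<nu>"
  proof -
    have "distr ?\<mu> ?\<nu> \<phi> = distr ?\<mu> paths \<phi>" by (rule distr_cong) auto
    also have "\<dots> = distr circle paths (\<phi> \<circ> itinerary a P)"
      unfolding \<mu> by (rule distr_distr[OF \<phi> mP])
    also have "\<dots> = distr circle paths (itinerary a Q)"
    proof (rule distr_cong_AE)
      show "AE x in circle. (\<phi> \<circ> itinerary a P) x = itinerary a Q x"
        using F(2) by eventually_elim (simp add: \<phi>_def)
    qed (use measurable_comp[OF mP \<phi>] mQ in auto)
    finally show ?thesis by (simp add: \<nu>)
  qed
  moreover have "AE \<omega> in ?\<mu>. \<psi> (\<phi> \<omega>) = \<omega>"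
  proof (rule AE_process_lawI[OF a P(1)])
    show "Measurable.pred paths (\<lambda>\<omega>. \<psi> (\<phi> \<omega>) = \<omega>)"
      by (rule pred_eq_paths[OF measurable_compose[OF \<phi> \<psi>]]) simp
    show "AE x in circle. \<psi> (\<phi> (itinerary a P x)) = itinerary a P x"
      using F(2) G(2) by eventually_elim (simp add: \<phi>_def \<psi>_def)
  qed
  moreover have "AE \<omega> in ?\<nu>. \<phi> (\<psi> \<omega>) = \<omega>"
  proof (rule AE_process_lawI[OF a Q(1)])
    show "Measurable.pred paths (\<lambda>\<omega>. \<phi> (\<psi> \<omega>) = \<omega>)"
      by (rule pred_eq_paths[OF measurable_compose[OF \<psi> \<phi>]]) simp
    show "AE x in circle. \<phi> (\<psi> (itinerary a Q x)) = itinerary a Q x"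
      using F(2) G(2) by eventually_elim (simp add: \<phi>_def \<psi>_def)
  qed
  moreover have "AE \<omega> in ?\<mu>. \<phi> (shift \<omega>) = shift (\<phi> \<omega>)"
  proof (rule AE_process_lawI[OF a P(1)])
    show "Measurable.pred paths (\<lambda>\<omega>. \<phi> (shift \<omega>) = shift (\<phi> \<omega>))"
      by (rule pred_eq_paths[OF measurable_compose[OF measurable_shift \<phi>]
            measurable_compose[OF \<phi> measurable_shift]])
    have "AE x in circle. F (itinerary a P (rotation a x)) = rotation a x"
      by (rule AE_comp_measure_preserving[OF measurable_rotation distr_rotation F(2)])
    then show "AE x in circle. \<phi> (shift (itinerary a P x)) = shift (\<phi> (itinerary a P x))"
      using F(2) by eventually_elim (simp add: \<phi>_def shift_itinerary)
  qed
  moreover have "\<phi> \<in> measurable ?\<mu> ?\<nu>" "\<psi> \<in> measurable ?\<nu> ?\<mu>"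
    using \<phi> \<psi> by (simp_all cong: measurable_cong_sets)
  ultimately show ?thesis
    unfolding isomorphic_processes_def isomorphic_systems_def by blast
qed

text \<open>Take the itinerary through \<open>P\<close>, apply the isomorphism, decode through
  \<open>Q\<close>. The decoder is equivariant almost surely for the second law, hence along the
  isomorphism, which carries the first law to the second.\<close>

lemma isomorphic_rotation_processes_factor:
  assumes a: "a \<in> {0..<1}" and P: "finite_partition circle P"
    and b: "b \<in> {0..<1}" and Q: "finite_partition circle Q" "generates circle (rotation b) Q"
    and iso: "process_law circle (rotation a) P \<cong>\<^sub>p process_law circle (rotation b) Q"
  obtains \<Psi> where "\<Psi> \<in> measurable circle circle"
    "AE x in circle. \<Psi> (rotation a x) = rotation b (\<Psi> x)"
proof -
  obtain G where G: "G \<in> measurable paths circle" "AE x in circle. G (itinerary b Q x) = x"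
    using generates_left_inverse[OF b Q] by blast
  let ?\<mu> = "process_law circle (rotation a) P" and ?\<nu> = "process_law circle (rotation b) Q"
  note mP = measurable_itinerary[OF a P(1)]
  obtain \<phi> where "\<phi> \<in> measurable ?\<mu> ?\<nu>" and d: "distr ?\<mu> ?\<nu> \<phi> = ?\<nu>"
    and eqv: "AE \<omega> in ?\<mu>. \<phi> (shift \<omega>) = shift (\<phi> \<omega>)"
    using iso unfolding isomorphic_processes_def isomorphic_systems_def by blast
  then have \<phi>: "\<phi> \<in> measurable paths paths" by (simp cong: measurable_cong_sets)
  have "AE \<omega> in ?\<nu>. G (shift \<omega>) = rotation b (G \<omega>)"
  proof (rule AE_process_lawI[OF b Q(1)])
    have G': "G \<in> borel_measurable paths" using G(1) by (simp add: measurable_circle_iff)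
    show "Measurable.pred paths (\<lambda>\<omega>. G (shift \<omega>) = rotation b (G \<omega>))"
      unfolding pred_def
      by (rule borel_measurable_eq[OF measurable_compose[OF measurable_shift G']
            measurable_compose[OF G' measurable_rotation_borel]])
    have "AE x in circle. G (itinerary b Q (rotation b x)) = rotation b x"
      by (rule AE_comp_measure_preserving[OF measurable_rotation distr_rotation G(2)])
    then show "AE x in circle. G (shift (itinerary b Q x)) = rotation b (G (itinerary b Q x))"
      using G(2) by eventually_elim (simp add: shift_itinerary)
  qed
  then have "AE \<omega> in ?\<mu>. G (shift (\<phi> \<omega>)) = rotation b (G (\<phi> \<omega>))"
    by (rule AE_comp_measure_preserving[OF \<open>\<phi> \<in> measurable ?\<mu> ?\<nu>\<close> d])
  with eqv have "AE \<omega> in ?\<mu>. G (\<phi> (shift \<omega>)) = rotation b (G (\<phi> \<omega>))"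
    by eventually_elim simp
  then have "AE x in circle. G (\<phi> (shift (itinerary a P x))) = rotation b (G (\<phi> (itinerary a P x)))"
    unfolding process_law_rotation[OF a] by (rule AE_distrD[OF mP])
  then show thesis
    by (intro that[of "\<lambda>x. G (\<phi> (itinerary a P x))"] measurable_compose[OF mP measurable_compose[OF \<phi> G(1)]])
       (simp add: shift_itinerary)
qed

section \<open>The value of the invariant on a rotation\<close>

lemma process_law_in_rotation_processes:
  assumes "a \<in> {0..<1} - \<rat>" "finite_partition circle P" "generates circle (rotation a) P"
  shows "process_law circle (rotation a) P \<in> \<R>"
proof -
  have sys: "is_system circle (rotation a)" using assms(1) by (intro is_system_rotation) simp
  then have "processes_of circle (rotation a) \<subseteq> \<R>"
    using processes_of_subset_rotation_processes[OF assms(1) sys isomorphic_systems_refl] by simp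
  then show ?thesis using assms(2,3) by (auto simp: processes_of_def)
qed

text \<open>All generating partitions of one rotation give isomorphic processes, and the half circle
  supplies one, so the definite description in \<open>common_value\<close> denotes a genuine
  value.\<close>

lemma rotation_value_image:
  assumes J: "isomorphism_invariant \<R> J" and a: "a \<in> {0..<1} - \<rat>"
  shows "J ` processes_of circle (rotation a) = {rotation_value J a}"
proof -
  let ?P = "cells {0..<1/2} {}"
  have P: "finite_partition circle ?P" "generates circle (rotation a) ?P"
    using finite_partition_cells[OF half_circle_in_sets, of "{}"] generates_half_circle[OF a, of "{}"]
    by auto
  let ?\<mu> = "process_law circle (rotation a) ?P"
  have "J \<nu> = J ?\<mu>" if "\<nu> \<in> processes_of circle (rotation a)" for \<nu>
  proof -
    obtain Q where Q: "finite_partition circle Q" "generates circle (rotation a) Q"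
      "\<nu> = process_law circle (rotation a) Q"
      using \<open>\<nu> \<in> _\<close> by (auto simp: processes_of_def)
    have "\<nu> \<cong>\<^sub>p ?\<mu>"
      unfolding Q(3) by (rule isomorphic_processes_same_rotation[OF _ Q(1,2) P]) (use a in simp)
    then show ?thesis
      using J process_law_in_rotation_processes[OF a] P Q unfolding isomorphism_invariant_def by blast
  qed
  moreover have "?\<mu> \<in> processes_of circle (rotation a)" using P by (auto simp: processes_of_def)
  ultimately have im: "J ` processes_of circle (rotation a) = {J ?\<mu>}" by blast
  then show ?thesis unfolding rotation_value_def common_value_def by simp
qed

lemma J_process_law:
  assumes "isomorphism_invariant \<R> J" "a \<in> {0..<1} - \<rat>"
    and "finite_partition circle P" "generates circle (rotation a) P"
  shows "J (process_law circle (rotation a) P) = rotation_value J a"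
  using rotation_value_image[OF assms(1,2)] assms(3,4) by (auto simp: processes_of_def)

section \<open>Names as random variables on the circle\<close>

lemma measurable_map_list:
  fixes f :: "'i \<Rightarrow> 'a \<Rightarrow> 'b::countable"
  assumes "\<And>i. i \<in> set is \<Longrightarrow> f i \<in> measurable M (count_space UNIV)"
  shows "(\<lambda>x. map (\<lambda>i. f i x) is) \<in> measurable M (count_space UNIV)"
  using assms
proof (induction "is")
  case (Cons i "is")
  have "(\<lambda>x. (#) (f i x) (map (\<lambda>i. f i x) is)) \<in> measurable M (count_space UNIV)"
    by (rule measurable_compose_countable[of "\<lambda>c x. c # map (\<lambda>i. f i x) is"])
       (use Cons in \<open>auto intro: measurable_compose[OF _ measurable_count_space]\<close>)
  then show ?case by simp
qed simp

lemma measurable_cell_code: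
  assumes [measurable]: "F \<in> sets borel" "A \<in> sets borel"
  shows "cell_code F A \<in> measurable borel (count_space UNIV)"
  unfolding cell_code_def[abs_def] by measurable

lemma measurable_orbit_name:
  assumes "F \<in> sets circle" "A \<in> sets circle"
  shows "orbit_name a F A n \<in> measurable circle (count_space UNIV)"
  unfolding orbit_name_def[abs_def] using assms
  by (intro measurable_map_list borel_measurable_circleI
        measurable_compose[OF measurable_rotation_borel measurable_cell_code])
     (auto simp: sets_circle_iff)

lemma measurable_orbit_name_set:
  assumes "F \<in> sets circle" "A \<in> sets circle"
  shows "{x \<in> {0..<1}. p (orbit_name a F A n x)} \<in> sets circle"
  using measurable_sets[OF measurable_orbit_name[OF assms], of "Collect p"]
  by (simp add: vimage_def Int_def conj_commute)

text \<open>Moves observation from path space to the circle, where names under different rotations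
  can be compared point by point.\<close>

lemma observation_tendsto:
  assumes obs: "observes \<R> s J" and J: "isomorphism_invariant \<R> J" and a: "a \<in> {0..<1} - \<rat>"
    and FA: "F \<in> sets circle" "A \<in> sets circle" and gen: "generates circle (rotation a) (cells F A)"
    and e: "\<epsilon> > 0"
  shows "(\<lambda>n. measure circle {x \<in> {0..<1}. dist (s (orbit_name a F A n x)) (rotation_value J a) > \<epsilon>})
    \<longlonglongrightarrow> 0"
proof -
  let ?\<mu> = "process_law circle (rotation a) (cells F A)"
  note P = finite_partition_cells[OF FA]
  have a': "a \<in> {0..<1}" using a by simp
  have Jv: "J ?\<mu> = rotation_value J a" by (rule J_process_law[OF J a P gen])
  have eq: "measure ?\<mu> {\<omega> \<in> space ?\<mu>. dist (s (map (\<lambda>i. \<omega> (int i)) [1..<Suc n])) (J ?\<mu>) > \<epsilon>} =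
      measure circle {x \<in> {0..<1}. dist (s (orbit_name a F A n x)) (rotation_value J a) > \<epsilon>}" for n
  proof -
    let ?D = "{\<omega>. dist (s (map (\<lambda>i. \<omega> (int i)) [1..<Suc n])) (J ?\<mu>) > \<epsilon>}"
    have "(\<lambda>\<omega>. map (\<lambda>i. \<omega> (int i)) [1..<Suc n]) \<in> measurable paths (count_space UNIV)"
      by (rule measurable_map_list) (rule measurable_coordinate)
    from measurable_sets[OF this, of "{l. dist (s l) (J ?\<mu>) > \<epsilon>}"]
    have D: "?D \<in> sets paths" by (simp add: vimage_def)
    have "map (\<lambda>i. itinerary a (cells F A) x (int i)) [1..<Suc n] = orbit_name a F A n x" for x
      by (simp add: itinerary_def orbit_name_def cell_index_cells)
    then have "itinerary a (cells F A) -` ?D \<inter> space circle =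
        {x \<in> {0..<1}. dist (s (orbit_name a F A n x)) (rotation_value J a) > \<epsilon>}"
      by (auto simp: Jv)
    then show ?thesis
      using measure_distr[OF measurable_itinerary[OF a' P] D]
      by (simp add: process_law_rotation[OF a'])
  qed
  have "?\<mu> \<in> \<R>" by (rule process_law_in_rotation_processes[OF a P gen])
  from bspec[OF obs[unfolded observes_def] this, rule_format, OF e]
  show ?thesis unfolding eq .
qed

section \<open>Category in the measure algebra\<close>

text \<open>Baire category for the pseudometric given by the measure of the symmetric difference, by
  nested balls. Working with sets directly avoids forming the quotient by null sets.\<close>

lemma measure_algebra_baire:
  assumes fm: "finite_measure M"
    and opn: "\<And>m A. A \<in> sets M \<Longrightarrow> A \<in> U m \<Longrightarrow>
      \<exists>\<delta>>0. \<forall>B\<in>sets M. measure M (sym_diff A B) < \<delta> \<longrightarrow> B \<in> U m"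
    and dense: "\<And>m A \<delta>. A \<in> sets M \<Longrightarrow> 0 < \<delta> \<Longrightarrow>
      \<exists>B\<in>sets M. measure M (sym_diff A B) < \<delta> \<and> B \<in> U m"
  shows "\<exists>A\<in>sets M. \<forall>m::nat. A \<in> U m"
proof -
  interpret finite_measure M by (rule fm)
  \<comment> \<open>States are pairs of a centre and a radius. Moves below a quarter of the radius,
    with radii at least halved each time, add up to at most half the radius, so the limit stays
    strictly inside every ball.\<close>
  define P where "P = (\<lambda>z. fst z \<in> sets M \<and> 0 < (snd z :: real))"
  define R where "R n z z' \<longleftrightarrow> measure M (sym_diff (fst z) (fst z')) < snd z / 4 \<and> snd z' \<le> snd z / 2 \<and>
    (\<forall>B\<in>sets M. measure M (sym_diff (fst z') B) < snd z' \<longrightarrow> B \<in> U n)"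
    for n :: nat and z z' :: "'a set \<times> real"
  have "\<exists>z. P z" by (rule exI[of _ "({}, 1)"]) (simp add: P_def)
  moreover have "\<exists>z'. P z' \<and> R n z z'" if z: "P z" for z n
  proof -
    obtain B where B: "B \<in> sets M" "measure M (sym_diff (fst z) B) < snd z / 4" "B \<in> U n"
      using dense[of "fst z" "snd z / 4" n] z by (auto simp: P_def)
    obtain \<delta> where "0 < \<delta>" "\<forall>C\<in>sets M. measure M (sym_diff B C) < \<delta> \<longrightarrow> C \<in> U n"
      using opn[OF B(1,3)] by blast
    then show ?thesis
      using B z by (intro exI[of _ "(B, min \<delta> (snd z / 2))"]) (auto simp: P_def R_def)
  qed
  ultimately obtain f where f: "\<And>n. P (f n)" "\<And>n. R n (f n) (f (Suc n))"
    using dependent_nat_choice[of "\<lambda>_. P" R] by metis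
  define A where "A n = fst (f n)" for n
  define \<delta> where "\<delta> n = snd (f n)" for n
  have A: "A n \<in> sets M" and \<delta>: "0 < \<delta> n" for n
    using f(1)[of n] by (auto simp: A_def \<delta>_def P_def)
  have step: "measure M (sym_diff (A n) (A (Suc n))) < \<delta> n / 4" and half: "\<delta> (Suc n) \<le> \<delta> n / 2"
    and ball: "B \<in> sets M \<Longrightarrow> measure M (sym_diff (A (Suc n)) B) < \<delta> (Suc n) \<Longrightarrow> B \<in> U n" for n B
    using f(2)[of n] by (auto simp: A_def \<delta>_def R_def)
  \<comment> \<open>The limit is the limsup of the centres: outside all later successive differences
    membership is constant, so \<open>L\<close> differs from a centre only on their union.\<close>
  define L where "L = (\<Inter>n. \<Union>k\<in>{n..}. A k)"
  have L: "L \<in> sets M" unfolding L_def using A by auto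
  have "L \<in> U m" for m
  proof (rule ball[OF L])
    \<comment> \<open>The ball secured for \<open>U m\<close> is the one around the centre of index
      m + 1.\<close>
    let ?m = "Suc m"
    let ?D = "\<lambda>j. sym_diff (A (?m + j)) (A (Suc (?m + j)))"
    have D: "range ?D \<subseteq> sets M" using A by auto
    have geo: "\<delta> (?m + j) \<le> \<delta> ?m * (1/2) ^ j" for j
    proof (induction j)
      case (Suc j)
      then show ?case using half[of "?m + j"] by simp
    qed simp
    have le: "measure M (?D j) \<le> \<delta> ?m / 4 * (1/2) ^ j" for j
      using step[of "?m + j"] geo[of j] by simp
    have sums: "(\<lambda>j. \<delta> ?m / 4 * (1/2) ^ j) sums (\<delta> ?m / 4 * 2)"
      using geometric_sums[of "1/2 :: real"] by (intro sums_mult) simp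
    have sD: "summable (\<lambda>j. measure M (?D j))"
      by (rule summable_comparison_test'[OF sums_summable[OF sums], of 0]) (use le in simp)
    have "sym_diff (A ?m) L \<subseteq> (\<Union>j. ?D j)"
    proof (rule ccontr)
      assume "\<not> ?thesis"
      then obtain x where x: "x \<in> sym_diff (A ?m) L" "\<And>j. x \<notin> ?D j" by blast
      have same: "x \<in> A (?m + j) \<longleftrightarrow> x \<in> A ?m" for j
      proof (induction j)
        case (Suc j)
        then show ?case using x(2)[of j] by auto
      qed simp
      have "x \<in> L \<longleftrightarrow> x \<in> A ?m"
      proof
        assume "x \<in> L"
        then obtain k where "k \<ge> ?m" "x \<in> A k" unfolding L_def by auto
        then show "x \<in> A ?m" using same[of "k - ?m"] by simp
      next
        assume xm: "x \<in> A ?m"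
        have "\<exists>k\<in>{n..}. x \<in> A k" for n
          using same[of n] xm by (intro bexI[of _ "?m + n"]) auto
        then show "x \<in> L" unfolding L_def by auto
      qed
      then show False using x(1) by auto
    qed
    then have "measure M (sym_diff (A ?m) L) \<le> measure M (\<Union>j. ?D j)"
      using A by (intro finite_measure_mono) auto
    also have "\<dots> \<le> (\<Sum>j. measure M (?D j))"
      by (rule finite_measure_subadditive_countably[OF D sD])
    also have "\<dots> \<le> (\<Sum>j. \<delta> ?m / 4 * (1/2) ^ j)"
      by (rule suminf_le[OF le sD sums_summable[OF sums]])
    also have "\<dots> < \<delta> ?m" using sums_unique[OF sums] \<delta>[of ?m] by simp
    finally show "measure M (sym_diff (A ?m) L) < \<delta> ?m" .
  qed
  then show ?thesis using L by blast
qed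

section \<open>Sets invariant under a dense set of rotations\<close>

lemma measure_circle_interval: "0 \<le> u \<Longrightarrow> u \<le> v \<Longrightarrow> v \<le> 1 \<Longrightarrow> measure circle {u..<v} = v - u"
  by (subst measure_circle) (auto simp: sets_circle_iff)

text \<open>The mass f(t) of \<open>E\<close> in [0, t) is Lipschitz and, by invariance, additive;
  hence f(t) = c t. So \<open>E\<close> is independent of every Borel set, in particular of itself,
  and c = c * c.\<close>

lemma dense_rotation_invariant_trivial:
  assumes E: "E \<in> sets circle"
    and dense: "\<And>c d. 0 \<le> c \<Longrightarrow> c < d \<Longrightarrow> d \<le> 1 \<Longrightarrow>
      \<exists>s. c < s \<and> s < d \<and> (AE x in circle. rotation s x \<in> E \<longleftrightarrow> x \<in> E)"
  shows "measure circle E = 0 \<or> measure circle E = 1"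
proof -
  define f where "f t = measure circle (E \<inter> {0..<t})" for t
  have icv: "{u..<v} \<in> sets circle" if "0 \<le> u" "v \<le> 1" for u v
    using that by (auto simp: sets_circle_iff)
  have diff: "f v - f u = measure circle (E \<inter> {u..<v})" if "0 \<le> u" "u \<le> v" "v \<le> 1" for u v
  proof -
    have "E \<inter> {0..<v} = (E \<inter> {0..<u}) \<union> (E \<inter> {u..<v})" using that by auto
    moreover have "measure circle \<dots> = f u + measure circle (E \<inter> {u..<v})"
      unfolding f_def by (rule circle.finite_measure_Union) (use E icv that in auto)
    ultimately show ?thesis by (simp add: f_def)
  qed
  have lip: "0 \<le> f v - f u" "f v - f u \<le> v - u" if "0 \<le> u" "u \<le> v" "v \<le> 1" for u v
  proof -
    have "measure circle (E \<inter> {u..<v}) \<le> measure circle {u..<v}"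
      by (rule circle.finite_measure_mono) (use icv that in auto)
    then show "0 \<le> f v - f u" "f v - f u \<le> v - u"
      using that by (auto simp: diff measure_circle_interval)
  qed
  \<comment> \<open>Under invariance by \<open>s\<close>, the part of \<open>E\<close> in [s, s + t)
    is a translate of its part in [0, t).\<close>
  have inv_add: "f (s + t) = f s + f t"
    if "AE x in circle. rotation s x \<in> E \<longleftrightarrow> x \<in> E" "0 \<le> s" "0 \<le> t" "s + t \<le> 1" for s t
  proof -
    have B: "E \<inter> {s..<s + t} \<in> sets circle" using E icv that by auto
    have iff: "rotation s x \<in> {s..<s + t} \<longleftrightarrow> x < t" if "0 \<le> x" "x < 1" for x
    proof (cases "x + s < 1")
      case True
      then show ?thesis using that \<open>0 \<le> s\<close> by (simp add: rotation_eq_add)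
    next
      case False
      have "rotation s x = rotation (s - 1) x" using frac_1_eq[of "s - 1"] by (intro rotation_cong) simp
      also have "\<dots> = x + (s - 1)"
        by (rule rotation_eq_add) (use False that \<open>0 \<le> t\<close> \<open>s + t \<le> 1\<close> in auto)
      finally show ?thesis using that False \<open>s + t \<le> 1\<close> by auto
    qed
    have "f (s + t) - f s = measure circle {x \<in> {0..<1}. rotation s x \<in> E \<inter> {s..<s + t}}"
      using that by (subst measure_rotation_vimage[OF B]) (simp add: diff)
    also have "\<dots> = measure circle (E \<inter> {0..<t})"
    proof (rule circle.finite_measure_eq_AE)
      show "AE x in circle. x \<in> {x \<in> {0..<1}. rotation s x \<in> E \<inter> {s..<s + t}} \<longleftrightarrow> x \<in> E \<inter> {0..<t}"
        using that(1) AE_space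
      proof eventually_elim
        case (elim x)
        then show ?case using iff[of x] by auto
      qed
    qed (use E icv that rotation_vimage_in_sets[OF B] in auto)
    finally show ?thesis by (simp add: f_def)
  qed
  have f0: "f 0 = 0" by (simp add: f_def)
  have add: "f (s + t) = f s + f t" if "0 \<le> s" "0 \<le> t" "s + t \<le> 1" for s t
  proof (cases "s = 0")
    case False
    have "\<bar>f (s + t) - f s - f t\<bar> \<le> e" if "e > 0" for e
    proof -
      \<comment> \<open>An admissible angle just below \<open>s\<close> replaces \<open>s\<close>;
        the Lipschitz bound controls the error.\<close>
      have "max 0 (s - e) < s" using \<open>0 \<le> s\<close> False that by auto
      then obtain u where u: "max 0 (s - e) < u" "u < s" "AE x in circle. rotation u x \<in> E \<longleftrightarrow> x \<in> E"
        using dense[of "max 0 (s - e)" s] \<open>0 \<le> t\<close> \<open>s + t \<le> 1\<close> by auto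
      have "f (u + t) = f u + f t"
        by (rule inv_add[OF u(3)]) (use u \<open>0 \<le> t\<close> \<open>s + t \<le> 1\<close> in auto)
      moreover have "0 \<le> f (s + t) - f (u + t)" "f (s + t) - f (u + t) \<le> s - u"
        using lip[of "u + t" "s + t"] u \<open>0 \<le> t\<close> \<open>s + t \<le> 1\<close> by auto
      moreover have "0 \<le> f s - f u" "f s - f u \<le> s - u"
        using lip[of u s] u \<open>0 \<le> t\<close> \<open>s + t \<le> 1\<close> by auto
      ultimately show ?thesis using u by auto
    qed
    then have "\<bar>f (s + t) - f s - f t\<bar> \<le> 0" by (rule field_le_epsilon) simp
    then show ?thesis by simp
  qed (use f0 in simp)
  define c where "c = measure circle E"
  have Esub: "E \<subseteq> {0..<1}" using E by (simp add: sets_circle_iff)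
  have f1: "f 1 = c" using Esub by (simp add: f_def c_def Int_absorb2)
  have c: "0 \<le> c" "c \<le> 1" by (auto simp: c_def)
  have grid: "f (real j / real n) = real j * f (1 / real n)" if "n > 0" "j \<le> n" for j n :: nat
    using that(2)
  proof (induction j)
    case (Suc j)
    have "f (real j / real n + 1 / real n) = f (real j / real n) + f (1 / real n)"
      by (rule add) (use that Suc in \<open>auto simp: field_simps\<close>)
    then show ?case using Suc by (simp add: add_divide_distrib algebra_simps)
  qed (simp add: f0)
  have lin: "f t = c * t" if t: "0 \<le> t" "t \<le> 1" for t
  proof -
    have "\<bar>f t - c * t\<bar> \<le> e" if "e > 0" for e
    proof -
      obtain n :: nat where n: "n > 0" "1 / real n < e"
        using \<open>e > 0\<close> by (metis gr0I inverse_eq_divide of_nat_0 real_arch_inverse less_irrefl)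
      \<comment> \<open>Round \<open>t\<close> down to the grid of step 1/n, on which additivity
        alone gives linearity.\<close>
      define j where "j = nat \<lfloor>t * real n\<rfloor>"
      have j: "real j \<le> t * real n" "t * real n < real j + 1"
        using t n by (auto simp: j_def) (linarith+)?
      have "j \<le> n"
      proof -
        have "t * real n \<le> real n" using t n by (simp add: mult_left_le_one_le)
        then show ?thesis using j by linarith
      qed
      have jn: "0 \<le> real j / real n" "real j / real n \<le> t" "t - real j / real n \<le> 1 / real n"
        using j n pos_le_divide_eq[of "real n" t "real j + 1"]
        by (auto simp: pos_divide_le_eq add_divide_distrib)
      have "f (real j / real n) = c * (real j / real n)"
        using grid[OF n(1) \<open>j \<le> n\<close>] grid[OF n(1) order_refl] n f1 by (simp add: field_simps)
      moreover have "0 \<le> f t - f (real j / real n)" "f t - f (real j / real n) \<le> t - real j / real n"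
        using lip[OF jn(1,2) t(2)] by auto
      moreover have "0 \<le> c * (t - real j / real n)" "c * (t - real j / real n) \<le> t - real j / real n"
        using c jn by (auto intro: mult_left_le_one_le)
      ultimately show ?thesis using jn(3) n(2) by (simp add: algebra_simps abs_le_iff)
    qed
    then have "\<bar>f t - c * t\<bar> \<le> 0" by (rule field_le_epsilon) simp
    then show ?thesis by simp
  qed
  have B01: "B \<inter> {0..<1} \<in> sets circle" if "B \<in> sets borel" for B
    using that by (auto simp: sets_circle_iff)
  have sig: "sigma_sets UNIV (range (\<lambda>a::real. {..<a})) = sets borel"
    unfolding borel_Iio by (subst sets_measure_of) auto
  \<comment> \<open>Both sides are measures in \<open>B\<close>, and they agree on the half-lines, a
    family closed under intersection.\<close>
  have indep: "measure circle (E \<inter> (B \<inter> {0..<1})) = c * measure circle (B \<inter> {0..<1})"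
    if "B \<in> sets borel" for B
  proof (rule sigma_sets_induct_disjoint[OF _ _ that[folded sig]])
    show "Int_stable (range (\<lambda>a::real. {..<a}))"
    proof -
      have "{..<a} \<inter> {..<b} = {..<min a b}" for a b :: real by auto
      then show ?thesis unfolding Int_stable_def by blast
    qed
  next
    fix A assume "A \<in> range (\<lambda>a::real. {..<a})"
    then obtain t where "A = {..<t}" by auto
    then have "A \<inter> {0..<1} = {0..<min (max t 0) 1}" by auto
    then show "measure circle (E \<inter> (A \<inter> {0..<1})) = c * measure circle (A \<inter> {0..<1})"
      using lin[of "min (max t 0) 1"] by (simp add: f_def measure_circle_interval)
  next
    fix A assume A: "A \<in> sigma_sets UNIV (range (\<lambda>a::real. {..<a}))"
      and IH: "measure circle (E \<inter> (A \<inter> {0..<1})) = c * measure circle (A \<inter> {0..<1})"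
    have "A \<inter> {0..<1} \<in> sets circle" using A B01 sig by blast
    moreover have "E \<inter> ((UNIV - A) \<inter> {0..<1}) = E - (E \<inter> (A \<inter> {0..<1}))"
      "(UNIV - A) \<inter> {0..<1} = space circle - (A \<inter> {0..<1})" using Esub by auto
    ultimately show "measure circle (E \<inter> ((UNIV - A) \<inter> {0..<1})) = c * measure circle ((UNIV - A) \<inter> {0..<1})"
      using E IH by (simp only: circle.prob_compl)
        (subst circle.finite_measure_Diff, auto simp: c_def algebra_simps)
  next
    fix A :: "nat \<Rightarrow> real set"
    assume dis: "disjoint_family A" and A: "range A \<subseteq> sigma_sets UNIV (range (\<lambda>a::real. {..<a}))"
      and IH: "\<And>i. measure circle (E \<inter> (A i \<inter> {0..<1})) = c * measure circle (A i \<inter> {0..<1})"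
    have m: "A i \<inter> {0..<1} \<in> sets circle" for i using A B01 sig by blast
    have "(\<lambda>i. measure circle (E \<inter> (A i \<inter> {0..<1}))) sums measure circle (\<Union>i. E \<inter> (A i \<inter> {0..<1}))"
      by (rule circle.finite_measure_UNION)
         (use E m dis in \<open>auto simp: disjoint_family_on_def\<close>)
    moreover have "(\<lambda>i. measure circle (A i \<inter> {0..<1})) sums measure circle (\<Union>i. A i \<inter> {0..<1})"
      by (rule circle.finite_measure_UNION)
         (use m dis in \<open>auto simp: disjoint_family_on_def\<close>)
    then have "(\<lambda>i. c * measure circle (A i \<inter> {0..<1})) sums (c * measure circle (\<Union>i. A i \<inter> {0..<1}))"
      by (rule sums_mult)
    moreover have "(\<Union>i. E \<inter> (A i \<inter> {0..<1})) = E \<inter> (\<Union> (range A) \<inter> {0..<1})"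
      "(\<Union>i. A i \<inter> {0..<1}) = \<Union> (range A) \<inter> {0..<1}" by auto
    ultimately show "measure circle (E \<inter> (\<Union> (range A) \<inter> {0..<1})) = c * measure circle (\<Union> (range A) \<inter> {0..<1})"
      unfolding IH by (metis sums_unique2)
  qed auto
  have "c = c * c"
    using indep[of E] E Esub by (simp add: sets_circle_iff Int_absorb2 c_def)
  then show ?thesis unfolding c_def[symmetric] by simp
qed

text \<open>Ergodicity of irrational rotations: invariance under \<open>a\<close> passes to its
  multiples, which are dense.\<close>

lemma rotation_invariant_trivial:
  assumes a: "a \<notin> \<rat>" and E: "E \<in> sets circle"
    and inv: "AE x in circle. rotation a x \<in> E \<longleftrightarrow> x \<in> E"
  shows "measure circle E = 0 \<or> measure circle E = 1"
proof (rule dense_rotation_invariant_trivial[OF E])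
  have "AE x in circle. rotation (real k * a) x \<in> E \<longleftrightarrow> x \<in> E" for k
  proof (induction k)
    case (Suc k)
    have "AE x in circle. rotation a (rotation (real k * a) x) \<in> E \<longleftrightarrow> rotation (real k * a) x \<in> E"
      by (rule AE_comp_measure_preserving[OF measurable_rotation distr_rotation inv])
    with Suc show ?case
      by eventually_elim (simp add: rotation_rotation algebra_simps)
  next
    case 0
    show ?case using AE_space by eventually_elim (simp add: rotation_0)
  qed
  then have inv': "AE x in circle. rotation (frac (real k * a)) x \<in> E \<longleftrightarrow> x \<in> E" for k by simp
  fix c d :: real assume "0 \<le> c" "c < d" "d \<le> 1"
  then obtain k where "c < frac (real k * a)" "frac (real k * a) < d"
    using rotation_orbit_approaches[OF a] by blast
  then show "\<exists>s. c < s \<and> s < d \<and> (AE x in circle. rotation s x \<in> E \<longleftrightarrow> x \<in> E)"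
    using inv' by blast
qed

section \<open>Halving the angle\<close>

lemma prob_orbit_meets_le:
  assumes D: "D \<in> sets circle"
  shows "measure circle {x \<in> {0..<1}. \<exists>j\<in>{1..n}. rotation (real j * a) x \<in> D} \<le> real n * measure circle D"
proof -
  have "{x \<in> {0..<1}. \<exists>j\<in>{1..n}. rotation (real j * a) x \<in> D} =
      (\<Union>j\<in>{1..n}. {x \<in> {0..<1}. rotation (real j * a) x \<in> D})" by auto
  also have "measure circle \<dots> \<le> (\<Sum>j\<in>{1..n}. measure circle {x \<in> {0..<1}. rotation (real j * a) x \<in> D})"
    by (rule circle.finite_measure_subadditive_finite) (simp, use rotation_vimage_in_sets[OF D] in blast)
  also have "\<dots> = real n * measure circle D" by (simp only: measure_rotation_vimage[OF D]) simp
  finally show ?thesis .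
qed

lemma orbit_meets_in_sets:
  assumes D: "D \<in> sets circle"
  shows "{x \<in> {0..<1}. \<exists>j\<in>{1..n::nat}. rotation (real j * a) x \<in> D} \<in> sets circle"
proof -
  have "{x \<in> {0..<1}. \<exists>j\<in>{1..n}. rotation (real j * a) x \<in> D} =
      (\<Union>j\<in>{1..n}. {x \<in> {0..<1}. rotation (real j * a) x \<in> D})" by auto
  also have "\<dots> \<in> sets circle" by (rule sets.finite_UN) (simp, rule rotation_vimage_in_sets[OF D])
  finally show ?thesis .
qed

text \<open>The maps y/2 and y/2 + 1/2 are the inverse branches of doubling; each halves lengths, so
  the preimage of \<open>G\<close> has twice the measure of the part of \<open>G\<close> in that
  half.\<close>

lemma measure_circle_halves:
  assumes G: "G \<in> sets circle"
  shows "measure circle {y \<in> {0..<1}. y / 2 \<in> G} + measure circle {y \<in> {0..<1}. y / 2 + 1 / 2 \<in> G} =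
    2 * measure circle G"
proof -
  have half: "measure circle {y \<in> {0..<1}. y / 2 + t \<in> G} = 2 * measure circle (G \<inter> {t..<t + 1/2})"
    if t: "0 \<le> t" "t + 1/2 \<le> 1" for t
  proof -
    let ?X = "G \<inter> {t..<t + 1/2}" and ?H = "{y \<in> {0..<1}. y / 2 + t \<in> G}"
    have X: "?X \<in> sets borel" and GB: "G \<in> sets borel" using G by (auto simp: sets_circle_iff)
    have Xc: "?X \<in> sets circle" using X G by (auto simp: sets_circle_iff)
    have H: "?H \<in> sets circle" by (intro Collect_circle_in_sets pred_sets2[OF GB]) measurable
    have eq: "(\<lambda>x. t + 1/2 * x) -` ?X = ?H" by (auto simp: field_simps)
    have "emeasure lborel ?X = emeasure (density (distr lborel borel (\<lambda>x. t + 1/2 * x)) (\<lambda>_. ennreal \<bar>1/2\<bar>)) ?X"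
      using lborel_real_affine[of "1/2" t] by simp
    also have "\<dots> = ennreal (1/2) * emeasure (distr lborel borel (\<lambda>x. t + 1/2 * x)) ?X"
      using X by (subst emeasure_density_const) auto
    also have "emeasure (distr lborel borel (\<lambda>x. t + 1/2 * x)) ?X = emeasure lborel ?H"
      using emeasure_distr[of "\<lambda>x. t + 1/2 * x" lborel borel ?X] X unfolding eq by simp
    finally have fin: "emeasure lborel ?X = ennreal (1/2) * emeasure lborel ?H" .
    have "enn2real (ennreal (1/2)) = 1/2" by (rule enn2real_ennreal) simp
    then have "measure lborel ?X = 1/2 * measure lborel ?H"
      unfolding measure_def fin enn2real_mult by (simp only:)
    then show ?thesis using measure_circle[OF Xc] measure_circle[OF H] by simp
  qed
  have "G = (G \<inter> {0..<1/2}) \<union> (G \<inter> {1/2..<1})" using G by (auto simp: sets_circle_iff)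
  then have "measure circle G = measure circle ((G \<inter> {0..<1/2}) \<union> (G \<inter> {1/2..<1}))" by simp
  also have "\<dots> = measure circle (G \<inter> {0..<1/2}) + measure circle (G \<inter> {1/2..<1})"
    by (rule circle.finite_measure_Union) (use G in \<open>auto simp: sets_circle_iff\<close>)
  finally show ?thesis using half[of 0] half[of "1/2"] by simp
qed

lemma frac_double_frac: "frac (2 * frac y) = frac (2 * y)" for y :: real
  by (metis frac_add_frac mult_2)

text \<open>A lift of a point \<open>y\<close> under the doubling map can be carried along its orbit until the
  orbit enters the arc \<open>[0, \<eta>)\<close>, where a new lift is chosen.\<close>

lemma approximate_lift:
  assumes a: "a \<notin> \<rat>" and ab: "frac (2 * b) = frac a" and \<eta>: "0 < \<eta>"
  obtains \<sigma> where "\<sigma> \<in> measurable circle circle"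
    "\<And>y. y \<in> {0..<1} \<Longrightarrow> frac (2 * \<sigma> y) = y"
    "\<And>y. y \<in> {0..<1} \<Longrightarrow> \<eta> \<le> rotation a y \<Longrightarrow> \<sigma> (rotation a y) = rotation b (\<sigma> y)"
proof -
  \<comment> \<open>\<open>\<tau>\<close> is the time since the last visit to [0, \<eta>), finite
    because backward orbits enter the arc. \<open>h\<close> goes back \<open>k\<close> steps, lifts
    by halving and returns along the rotation by \<open>b\<close>.\<close>
  define \<tau> where "\<tau> y = (LEAST k::nat. rotation (- real k * a) y < \<eta>)" for y
  define h where "h k y = rotation (real k * b) (rotation (- real k * a) y / 2)" for k y
  define \<sigma> where "\<sigma> y = h (\<tau> y) y" for y
  have [measurable]: "\<tau> \<in> measurable borel (count_space UNIV)"
    unfolding \<tau>_def by (rule measurable_Least) measurable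
  have "\<sigma> \<in> borel_measurable borel"
    unfolding \<sigma>_def by (rule measurable_compose_countable[of h]) (simp_all add: h_def)
  then have "\<sigma> \<in> measurable circle circle"
    by (auto simp: measurable_circle_iff \<sigma>_def h_def intro: borel_measurable_circleI)
  moreover have "frac (2 * \<sigma> y) = y" if "y \<in> {0..<1}" for y
  proof -
    let ?k = "real (\<tau> y)"
    \<comment> \<open>As 2b - a is an integer, each step of the lift covers a step by
      \<open>a\<close>.\<close>
    have "2 * b - a = of_int (\<lfloor>2 * b\<rfloor> - \<lfloor>a\<rfloor>)" using ab by (simp add: frac_def)
    then have ab': "2 * b - a \<in> \<int>" by (metis Ints_of_int)
    have "frac (2 * \<sigma> y) = frac (rotation (- ?k * a) y + ?k * a + of_nat (\<tau> y) * (2 * b - a))"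
      unfolding \<sigma>_def h_def rotation_def[of "?k * b"] frac_double_frac by (simp add: algebra_simps)
    also have "\<dots> = frac (rotation (- ?k * a) y + ?k * a)"
      using ab' by (metis Ints_mult Ints_of_nat frac_add_int_right)
    also have "\<dots> = rotation (?k * a) (rotation (- ?k * a) y)" by (simp add: rotation_def)
    also have "\<dots> = y" using that by (simp add: rotation_rotation rotation_0)
    finally show ?thesis .
  qed
  moreover have "\<sigma> (rotation a y) = rotation b (\<sigma> y)" if y: "y \<in> {0..<1}" "\<eta> \<le> rotation a y" for y
  proof -
    obtain k :: nat where k: "rotation (- real k * a) (rotation a y) < \<eta>"
      using rotation_orbit_hits[OF a \<eta>, of "rotation a y"] by auto
    have S: "rotation (- real (Suc k) * a) (rotation a y) = rotation (- real k * a) y" for k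
      by (simp add: rotation_rotation algebra_simps)
    \<comment> \<open>Off the arc no new lift is chosen and the elapsed time grows by one.\<close>
    have "\<tau> (rotation a y) = Suc (\<tau> y)"
      unfolding \<tau>_def
    proof (subst Least_Suc[where P = "\<lambda>k. rotation (- real k * a) (rotation a y) < \<eta>", OF k])
      show "\<not> rotation (- real 0 * a) (rotation a y) < \<eta>" using y by (simp add: rotation_0)
    qed (simp only: S)
    then show ?thesis
      unfolding \<sigma>_def h_def by (simp only: S) (simp add: rotation_rotation algebra_simps)
  qed
  ultimately show thesis by (rule that)
qed

text \<open>With \<open>A'\<close> and the half circle as preimages of \<open>Q\<close> and
  \<open>F'\<close> under the lift, names agree as long as the orbit avoids [0, \<eta>) up to time
  \<open>n\<close>; the exceptional points have measure at most n \<eta>. \<open>A'\<close> differs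
  from \<open>A\<close> only where the lift falls into [0, d), hence inside [0, 2d).\<close>

lemma approximate_lift_names:
  assumes \<sigma>: "\<sigma> \<in> measurable circle circle"
    "\<And>y. y \<in> {0..<1} \<Longrightarrow> frac (2 * \<sigma> y) = y"
    "\<And>y. y \<in> {0..<1} \<Longrightarrow> \<eta> \<le> rotation a y \<Longrightarrow> \<sigma> (rotation a y) = rotation b (\<sigma> y)"
    and A: "A \<in> sets circle" and d: "0 < d" "d \<le> 1 / 2" and \<eta>: "0 < \<eta>" "real n * \<eta> \<le> e"
    and F': "F' = {x \<in> {0..<1}. frac (2 * x) < 1/2}"
    and Q: "Q = {x \<in> {0..<1}. frac (2 * x) \<in> A \<longleftrightarrow> \<not> x < d}"
    and G: "{x \<in> {0..<1}. p (orbit_name b F' Q n x)} = G" "G \<in> sets circle"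
  shows "\<exists>A'\<in>sets circle. measure circle (sym_diff A A') \<le> 2 * d \<and>
    measure circle {y \<in> {0..<1}. \<sigma> y \<in> G} - e
      \<le> measure circle {y \<in> {0..<1}. p (orbit_name a {0..<1/2} A' n y)}"
proof -
  have \<sigma>r: "0 \<le> \<sigma> y" "\<sigma> y < 1" if "y \<in> {0..<1}" for y
    using measurable_space[OF \<sigma>(1)] that by auto
  define A' where "A' = {y \<in> {0..<1}. y \<in> A \<longleftrightarrow> \<not> \<sigma> y < d}"
  have Ed: "{0..<d} \<in> sets circle" using d by (auto simp: sets_circle_iff)
  have vim: "{y \<in> {0..<1}. \<sigma> y \<in> X} \<in> sets circle" if "X \<in> sets circle" for X
    using measurable_sets[OF \<sigma>(1) that] by (simp add: vimage_def Int_def conj_commute)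
  have A'eq: "A' = sym_diff A {y \<in> {0..<1}. \<sigma> y \<in> {0..<d}}"
    using A \<sigma>r by (auto simp: A'_def sets_circle_iff)
  then have A': "A' \<in> sets circle" using A vim[OF Ed] by auto
  have "sym_diff A A' \<subseteq> {0..<2 * d}"
  proof
    fix y assume y: "y \<in> sym_diff A A'"
    then have y': "y \<in> {0..<1}" "0 \<le> \<sigma> y" "\<sigma> y < d" by (auto simp: A'eq)
    moreover have "y = 2 * \<sigma> y" using \<sigma>(2)[OF y'(1)] y' d by (simp add: frac_eq)
    ultimately show "y \<in> {0..<2 * d}" by auto
  qed
  then have "measure circle (sym_diff A A') \<le> measure circle {0..<2 * d}"
    using d by (intro circle.finite_measure_mono) (auto simp: sets_circle_iff)
  then have close: "measure circle (sym_diff A A') \<le> 2 * d" using d by (simp add: measure_circle_interval)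
  \<comment> \<open>The minimum with 1 keeps the arc inside the circle when \<open>\<eta>\<close> is
    large.\<close>
  define bad where "bad = {y \<in> {0..<1}. \<exists>j\<in>{1..n}. rotation (real j * a) y \<in> {0..<min \<eta> 1}}"
  have icv: "{0..<min \<eta> 1} \<in> sets circle" by (auto simp: sets_circle_iff)
  have bad: "bad \<in> sets circle" unfolding bad_def by (rule orbit_meets_in_sets[OF icv])
  have "measure circle bad \<le> real n * measure circle {0..<min \<eta> 1}"
    unfolding bad_def by (rule prob_orbit_meets_le[OF icv])
  also have "\<dots> \<le> real n * \<eta>" using \<eta> by (intro mult_left_mono) (auto simp: measure_circle_interval)
  finally have bad_le: "measure circle bad \<le> e" using \<eta> by simp
  have same: "orbit_name a {0..<1/2} A' n y = orbit_name b F' Q n (\<sigma> y)" if y: "y \<in> {0..<1}" "y \<notin> bad" for y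
  proof -
    have orb: "\<sigma> (rotation (real j * a) y) = rotation (real j * b) (\<sigma> y)" if "j \<le> n" for j
      using that
    proof (induction j)
      case 0
      then show ?case using y \<sigma>r by (simp add: rotation_0)
    next
      case (Suc j)
      have S: "rotation (real (Suc j) * c) z = rotation c (rotation (real j * c) z)" for c z
        by (simp add: rotation_rotation algebra_simps)
      have "\<not> rotation (real (Suc j) * a) y < min \<eta> 1"
        using y Suc.prems unfolding bad_def by force
      then have "\<eta> \<le> rotation a (rotation (real j * a) y)" unfolding S by simp
      then show ?case
        unfolding S using Suc by (subst \<sigma>(3)) auto
    qed
    have "cell_code {0..<1/2} A' z = cell_code F' Q (\<sigma> z)" if z: "z \<in> {0..<1}" for z
      using z \<sigma>(2)[OF z] \<sigma>r[OF z] by (simp add: cell_code_def A'_def F' Q)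
    then have "cell_code {0..<1/2} A' (rotation (real j * a) y) = cell_code F' Q (rotation (real j * b) (\<sigma> y))"
      if "j \<le> n" for j
      using orb[OF that] by simp
    then show ?thesis unfolding orbit_name_def by (intro map_cong) auto
  qed
  let ?N = "{y \<in> {0..<1}. p (orbit_name a {0..<1/2} A' n y)}"
  have N: "?N \<in> sets circle" by (rule measurable_orbit_name_set[OF half_circle_in_sets A'])
  have "{y \<in> {0..<1}. \<sigma> y \<in> G} \<subseteq> ?N \<union> bad" using same G(1) by auto
  then have "measure circle {y \<in> {0..<1}. \<sigma> y \<in> G} \<le> measure circle (?N \<union> bad)"
    using N bad by (intro circle.finite_measure_mono) auto
  also have "\<dots> \<le> measure circle ?N + measure circle bad"
    by (rule measure_Un_le[OF N bad])
  finally show ?thesis using A' close bad_le by (intro bexI[of _ A']) auto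
qed

text \<open>A single lift may distort measure and miss much of the set of points with good names. A
  lift and its half turn together run through both points of each fibre, so the preimages of that
  set have its measure as their average, and one of them is at least as large.\<close>

lemma doubling_names_copy:
  assumes a: "a \<notin> \<rat>" and ab: "frac (2 * b) = frac a"
    and A: "A \<in> sets circle" and d: "0 < d" "d \<le> 1 / 2" and e: "0 < e"
    and F': "F' = {x \<in> {0..<1}. frac (2 * x) < 1/2}"
    and Q: "Q = {x \<in> {0..<1}. frac (2 * x) \<in> A \<longleftrightarrow> \<not> x < d}"
  shows "\<exists>A'\<in>sets circle. measure circle (sym_diff A A') \<le> 2 * d \<and>
    measure circle {x \<in> {0..<1}. p (orbit_name b F' Q n x)} - e
      \<le> measure circle {y \<in> {0..<1}. p (orbit_name a {0..<1/2} A' n y)}"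
proof -
  \<comment> \<open>Makes n \<eta> \<le> e; the denominator n + 1 also covers n = 0.\<close>
  define \<eta> where "\<eta> = e / (real n + 1)"
  have \<eta>: "0 < \<eta>" "real n * \<eta> \<le> e" using e by (auto simp: \<eta>_def field_simps)
  obtain \<sigma> where \<sigma>: "\<sigma> \<in> measurable circle circle"
    "\<And>y. y \<in> {0..<1} \<Longrightarrow> frac (2 * \<sigma> y) = y"
    "\<And>y. y \<in> {0..<1} \<Longrightarrow> \<eta> \<le> rotation a y \<Longrightarrow> \<sigma> (rotation a y) = rotation b (\<sigma> y)"
    using approximate_lift[OF a ab \<eta>(1)] by blast
  have \<sigma>r: "0 \<le> \<sigma> y" "\<sigma> y < 1" if "y \<in> {0..<1}" for y
    using measurable_space[OF \<sigma>(1)] that by auto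
  define \<sigma>' where "\<sigma>' y = rotation (1/2) (\<sigma> y)" for y
  have \<sigma>': "\<sigma>' \<in> measurable circle circle"
    unfolding \<sigma>'_def by (rule measurable_compose[OF \<sigma>(1) measurable_rotation])
  have \<sigma>'2: "frac (2 * \<sigma>' y) = y" if "y \<in> {0..<1}" for y
    using \<sigma>(2)[OF that] frac_1_eq[of "2 * \<sigma> y"] by (simp add: \<sigma>'_def rotation_def frac_double_frac algebra_simps)
  have \<sigma>'3: "\<sigma>' (rotation a y) = rotation b (\<sigma>' y)" if "y \<in> {0..<1}" "\<eta> \<le> rotation a y" for y
    using \<sigma>(3)[OF that] by (simp add: \<sigma>'_def rotation_rotation add.commute)
  define G where "G = {x \<in> {0..<1}. p (orbit_name b F' Q n x)}"
  have F'Q: "F' \<in> sets circle" "Q \<in> sets circle"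
    using A unfolding F' Q by (intro Collect_circle_in_sets; auto simp: sets_circle_iff)+
  have G: "G \<in> sets circle" unfolding G_def by (rule measurable_orbit_name_set[OF F'Q])
  have vim: "{y \<in> {0..<1}. s y \<in> G} \<in> sets circle" if "s \<in> measurable circle circle" for s
    using measurable_sets[OF that G] by (simp add: vimage_def Int_def conj_commute)
  have vimH: "{y \<in> {0..<1}. y / 2 + t \<in> G} \<in> sets circle" for t
  proof (intro Collect_circle_in_sets pred_sets2)
    show "G \<in> sets borel" using G by (simp add: sets_circle_iff)
  qed measurable
  have sum_prob: "(\<integral>y. indicator X y + indicator Y y \<partial>circle) = measure circle X + measure circle Y"
    if "X \<in> sets circle" "Y \<in> sets circle" for X Y
    using that sets.Int_space_eq2[of X circle] sets.Int_space_eq2[of Y circle]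
    by (subst Bochner_Integration.integral_add) (auto simp: integrable_real_indicator less_top[symmetric])
  \<comment> \<open>The two lifts of \<open>y\<close> are y/2 and y/2 + 1/2 in some order.\<close>
  have ind: "indicator {y \<in> {0..<1}. \<sigma> y \<in> G} y + indicator {y \<in> {0..<1}. \<sigma>' y \<in> G} y =
      (indicator {y \<in> {0..<1}. y / 2 + 0 \<in> G} y + indicator {y \<in> {0..<1}. y / 2 + 1 / 2 \<in> G} y :: real)"
    if y: "y \<in> space circle" for y
  proof (cases "\<sigma> y < 1/2")
    case True
    then have e1: "y / 2 + 0 = \<sigma> y" using \<sigma>(2)[of y] \<sigma>r[of y] y by (simp add: frac_eq)
    then have e2: "y / 2 + 1 / 2 = \<sigma>' y"
      using True \<sigma>r[of y] y by (simp add: \<sigma>'_def rotation_eq_add)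
    show ?thesis unfolding indicator_def mem_Collect_eq e1 e2 by (rule refl)
  next
    case False
    have "frac (2 * \<sigma> y) = frac (2 * \<sigma> y - 1)" using frac_1_eq[of "2 * \<sigma> y - 1"] by simp
    also have "\<dots> = 2 * \<sigma> y - 1" using False \<sigma>r[of y] y by (simp add: frac_eq)
    finally have e2: "y / 2 + 1 / 2 = \<sigma> y" using \<sigma>(2)[of y] y by simp
    have "\<sigma>' y = rotation (- 1/2) (\<sigma> y)"
      unfolding \<sigma>'_def by (rule rotation_cong) (use frac_1_eq[of "- 1/2"] in simp)
    then have e1: "y / 2 + 0 = \<sigma>' y" using y by (simp add: rotation_eq_add flip: e2)
    show ?thesis unfolding indicator_def mem_Collect_eq e1 e2 by (rule add.commute)
  qed
  have "measure circle {y \<in> {0..<1}. \<sigma> y \<in> G} + measure circle {y \<in> {0..<1}. \<sigma>' y \<in> G} =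
     (\<integral>y. indicator {y \<in> {0..<1}. \<sigma> y \<in> G} y + indicator {y \<in> {0..<1}. \<sigma>' y \<in> G} y \<partial>circle)"
    by (rule sum_prob[OF vim[OF \<sigma>(1)] vim[OF \<sigma>'], symmetric])
  also have "\<dots> = (\<integral>y. indicator {y \<in> {0..<1}. y / 2 + 0 \<in> G} y +
      indicator {y \<in> {0..<1}. y / 2 + 1 / 2 \<in> G} y \<partial>circle)"
    by (rule Bochner_Integration.integral_cong[OF refl ind])
  also have "\<dots> = measure circle {y \<in> {0..<1}. y / 2 + 0 \<in> G} + measure circle {y \<in> {0..<1}. y / 2 + 1 / 2 \<in> G}"
    by (rule sum_prob[OF vimH vimH])
  also have "\<dots> = 2 * measure circle G" using measure_circle_halves[OF G] by simp
  finally have "measure circle {y \<in> {0..<1}. \<sigma> y \<in> G} \<ge> measure circle G \<or>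
      measure circle {y \<in> {0..<1}. \<sigma>' y \<in> G} \<ge> measure circle G" by linarith
  then show ?thesis
  proof
    assume *: "measure circle {y \<in> {0..<1}. \<sigma> y \<in> G} \<ge> measure circle G"
    show ?thesis
      using approximate_lift_names[OF \<sigma> A d \<eta> F' Q G_def[symmetric] G] * unfolding G_def[symmetric]
      by force
  next
    assume *: "measure circle {y \<in> {0..<1}. \<sigma>' y \<in> G} \<ge> measure circle G"
    show ?thesis
      using approximate_lift_names[OF \<sigma>' \<sigma>'2 \<sigma>'3 A d \<eta> F' Q G_def[symmetric] G] * unfolding G_def[symmetric]
      by force
  qed
qed

text \<open>Partitions whose names look like those of the rotation by \<open>b\<close> at infinitely many lengths
  form a residual set in the measure algebra, while every partition considered generates the
  rotation by \<open>a\<close>.\<close>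

lemma rotation_value_double:
  fixes J :: "process \<Rightarrow> 'd::metric_space"
  assumes obs: "observes \<R> s J" and J: "isomorphism_invariant \<R> J"
    and a: "a \<in> {0..<1} - \<rat>" and b: "b \<in> {0..<1} - \<rat>" and ab: "frac (2 * b) = a"
  shows "rotation_value J a = rotation_value J b"
proof (rule ccontr)
  let ?F = "{0..<1/2} :: real set"
  let ?c = "rotation_value J a" and ?d = "rotation_value J b"
  assume "?c \<noteq> ?d"
  \<comment> \<open>With half the distance, a reading closer than \<open>\<epsilon>\<close> to the
    value for \<open>b\<close> is farther than \<open>\<epsilon>\<close> from the value for
    \<open>a\<close>.\<close>
  define \<epsilon> where "\<epsilon> = dist ?c ?d / 2"
  have \<epsilon>: "0 < \<epsilon>" using \<open>?c \<noteq> ?d\<close> by (simp add: \<epsilon>_def)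
  define N where "N A n = {x \<in> {0..<1}. dist (s (orbit_name a ?F A n x)) ?d < \<epsilon>}" for A n
  \<comment> \<open>Exceeding 1/2 at arbitrarily late times contradicts convergence to the value for
    \<open>a\<close>.\<close>
  define U where "U m = {A. \<exists>n\<ge>m. measure circle (N A n) > 1 / 2}" for m :: nat
  have N: "N A n \<in> sets circle" if "A \<in> sets circle" for A n
    unfolding N_def
    by (rule measurable_orbit_name_set[OF half_circle_in_sets that, of "\<lambda>l. dist (s l) ?d < \<epsilon>"])
  have "\<exists>A\<in>sets circle. \<forall>m. A \<in> U m"
  proof (rule measure_algebra_baire)
    show "finite_measure circle" by (rule circle.finite_measure_axioms)
  next
    fix m A assume A: "A \<in> sets circle" "A \<in> U m"
    then obtain n where n: "n \<ge> m" "measure circle (N A n) > 1 / 2" by (auto simp: U_def)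
    \<comment> \<open>The margin above 1/2. A set within \<kappa> / (n + 1) of \<open>A\<close>
      changes the n-name on a set of measure less than \<open>\<kappa>\<close>.\<close>
    define \<kappa> where "\<kappa> = measure circle (N A n) - 1 / 2"
    have \<kappa>: "0 < \<kappa>" using n by (simp add: \<kappa>_def)
    have "B \<in> U m" if B: "B \<in> sets circle" "measure circle (sym_diff A B) < \<kappa> / (real n + 1)" for B
    proof -
      let ?D = "sym_diff A B"
      have D: "?D \<in> sets circle" using A(1) B(1) by (intro sets.Un sets.Diff)
      let ?M = "{x \<in> {0..<1}. \<exists>j\<in>{1..n}. rotation (real j * a) x \<in> ?D}"
      have "orbit_name a ?F A n x = orbit_name a ?F B n x" if "\<forall>j\<in>{1..n}. rotation (real j * a) x \<notin> ?D" for x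
      proof -
        have "cell_code ?F A (rotation (real j * a) x) = cell_code ?F B (rotation (real j * a) x)"
          if j: "j \<in> set [1..<Suc n]" for j
        proof -
          have "j \<in> {1..n}" using j by auto
          then have "rotation (real j * a) x \<notin> ?D"
            using \<open>\<forall>j\<in>{1..n}. rotation (real j * a) x \<notin> ?D\<close> by blast
          then have "rotation (real j * a) x \<in> A \<longleftrightarrow> rotation (real j * a) x \<in> B" by blast
          then show ?thesis unfolding cell_code_def by presburger
        qed
        then show ?thesis unfolding orbit_name_def by (rule map_cong[OF refl])
      qed
      then have "N A n \<subseteq> N B n \<union> ?M" by (auto simp: N_def)
      then have "measure circle (N A n) \<le> measure circle (N B n \<union> ?M)"
        using N[OF B(1)] orbit_meets_in_sets[OF D] by (intro circle.finite_measure_mono sets.Un)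
      also have "\<dots> \<le> measure circle (N B n) + measure circle ?M"
        by (rule measure_Un_le[OF N[OF B(1)] orbit_meets_in_sets[OF D]])
      finally have "measure circle (N A n) \<le> measure circle (N B n) + measure circle ?M" .
      moreover have "measure circle ?M \<le> real n * measure circle ?D" by (rule prob_orbit_meets_le[OF D])
      moreover have "real n * measure circle ?D < \<kappa>"
      proof -
        have "real n * measure circle ?D \<le> real n * (\<kappa> / (real n + 1))"
          using B(2) by (intro mult_left_mono) auto
        also have "\<dots> < \<kappa>" using \<kappa> by (simp add: field_simps)
        finally show ?thesis .
      qed
      ultimately have "measure circle (N B n) > 1 / 2" unfolding \<kappa>_def by linarith
      then show ?thesis using n by (auto simp: U_def)
    qed
    then show "\<exists>\<delta>>0. \<forall>B\<in>sets circle. measure circle (sym_diff A B) < \<delta> \<longrightarrow> B \<in> U m"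
      using \<kappa> by (intro exI[of _ "\<kappa> / (real n + 1)"]) auto
  next
    fix m A and \<delta> :: real assume A: "A \<in> sets circle" and \<delta>: "0 < \<delta>"
    \<comment> \<open>The copy moves \<open>A\<close> by at most 2d, kept below
      \<open>\<delta>\<close> by the third; 1/2 is the longest arc on which doubling is
      injective.\<close>
    define d where "d = min (1 / 2) (\<delta> / 3)"
    have d: "0 < d" "d \<le> 1 / 2" "2 * d < \<delta>" using \<delta> by (auto simp: d_def min_def)
    define F' where "F' = {x \<in> {0..<1::real}. frac (2 * x) < 1/2}"
    define Q where "Q = {x \<in> {0..<1}. frac (2 * x) \<in> A \<longleftrightarrow> \<not> x < d}"
    have F'Q: "F' \<in> sets circle" "Q \<in> sets circle"
      using A unfolding F'_def Q_def by (intro Collect_circle_in_sets; auto simp: sets_circle_iff)+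
    have gen: "generates circle (rotation b) (cells F' Q)"
      unfolding F'_def Q_def by (rule generates_doubling[OF b A d(1,2)])
    \<comment> \<open>The perturbed pullback generates the rotation by \<open>b\<close>, so the
      scheme converges on it to the value for \<open>b\<close>. The radius \<epsilon>/2 makes every
      point off the far set closer than \<open>\<epsilon>\<close>.\<close>
    have "(\<lambda>n. measure circle {x \<in> {0..<1}. dist (s (orbit_name b F' Q n x)) ?d > \<epsilon> / 2}) \<longlonglongrightarrow> 0"
      by (rule observation_tendsto[OF obs J b F'Q gen]) (use \<epsilon> in simp)
    then have "\<forall>\<^sub>F n in sequentially. measure circle {x \<in> {0..<1}. dist (s (orbit_name b F' Q n x)) ?d > \<epsilon> / 2} < 1/4"
      by (rule order_tendstoD) simp
    then obtain n where n: "n \<ge> m"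
      "measure circle {x \<in> {0..<1}. dist (s (orbit_name b F' Q n x)) ?d > \<epsilon> / 2} < 1/4"
      unfolding eventually_sequentially by (metis nat_le_linear)
    let ?far = "{x \<in> {0..<1}. dist (s (orbit_name b F' Q n x)) ?d > \<epsilon> / 2}"
    let ?near = "{x \<in> {0..<1}. dist (s (orbit_name b F' Q n x)) ?d < \<epsilon>}"
    have "measure circle (space circle - ?far) \<le> measure circle ?near"
      using \<epsilon> by (intro circle.finite_measure_mono measurable_orbit_name_set[OF F'Q, of "\<lambda>l. dist (s l) ?d < \<epsilon>"]) auto
    then have near: "measure circle ?near > 3 / 4"
      using n(2) circle.prob_compl[OF measurable_orbit_name_set[OF F'Q, of "\<lambda>l. dist (s l) ?d > \<epsilon> / 2"]]
      by simp
    have ab': "frac (2 * b) = frac a" using ab by (metis frac_frac)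
    \<comment> \<open>A measure above 3/4 loses at most 1/8 in the copy and stays above 1/2.\<close>
    have "a \<notin> \<rat>" "0 < (1/8 :: real)" using a by simp_all
    from doubling_names_copy[OF this(1) ab' A d(1,2) this(2) F'_def Q_def, of "\<lambda>l. dist (s l) ?d < \<epsilon>" n]
    obtain B where B: "B \<in> sets circle" "measure circle (sym_diff A B) \<le> 2 * d"
      "measure circle ?near - 1 / 8 \<le> measure circle (N B n)"
      unfolding N_def by blast
    then have "B \<in> U m" using near n by (auto simp: U_def)
    then show "\<exists>B\<in>sets circle. measure circle (sym_diff A B) < \<delta> \<and> B \<in> U m"
      using B d by (intro bexI[of _ B]) auto
  qed
  then obtain A where A: "A \<in> sets circle" "\<And>m. A \<in> U m" by blast
  let ?far = "\<lambda>n. {x \<in> {0..<1}. dist (s (orbit_name a ?F A n x)) ?c > \<epsilon>}"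
  \<comment> \<open>The set found by category still generates the rotation by \<open>a\<close>
    together with the half circle, so on it the scheme must converge to the value for
    \<open>a\<close>.\<close>
  have "(\<lambda>n. measure circle (?far n)) \<longlonglongrightarrow> 0"
    by (rule observation_tendsto[OF obs J a half_circle_in_sets A(1) generates_half_circle[OF a A(1)] \<epsilon>])
  then have "\<forall>\<^sub>F n in sequentially. measure circle (?far n) < 1/2"
    by (rule order_tendstoD) simp
  then obtain m where m: "\<And>n. n \<ge> m \<Longrightarrow> measure circle (?far n) < 1/2"
    unfolding eventually_sequentially by blast
  obtain n where n: "n \<ge> m" "measure circle (N A n) > 1/2" using A(2)[of m] by (auto simp: U_def)
  have "dist l ?c > \<epsilon>" if "dist l ?d < \<epsilon>" for l
    using dist_triangle2[of ?c ?d l] that by (simp add: \<epsilon>_def dist_commute)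
  then have "N A n \<subseteq> ?far n" by (auto simp: N_def)
  then have "measure circle (N A n) \<le> measure circle (?far n)"
    by (intro circle.finite_measure_mono
        measurable_orbit_name_set[OF half_circle_in_sets A(1), of "\<lambda>l. dist (s l) ?c > \<epsilon>"])
  then show False using m[OF n(1)] n(2) by simp
qed

section \<open>Constancy almost everywhere\<close>

lemma frac_in_Rats_iff: "frac x \<in> \<rat> \<longleftrightarrow> x \<in> \<rat>" for x :: real
proof
  assume "frac x \<in> \<rat>"
  then have "frac x + of_int \<lfloor>x\<rfloor> \<in> \<rat>" by (intro Rats_add) auto
  then show "x \<in> \<rat>" by (simp add: frac_def)
qed (simp add: frac_def)

lemma Rats_mult_nat_iff: "n > 0 \<Longrightarrow> real n * x \<in> \<rat> \<longleftrightarrow> x \<in> \<rat>"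
proof
  assume "n > 0" "real n * x \<in> \<rat>"
  then have "real n * x / real n \<in> \<rat>" by (intro Rats_divide) auto
  then show "x \<in> \<rat>" using \<open>n > 0\<close> by simp
qed auto

lemma rotation_value_frac_power2:
  assumes obs: "observes \<R> s J" and J: "isomorphism_invariant \<R> J" and b: "b \<in> {0..<1} - \<rat>"
  shows "rotation_value J (frac (2 ^ m * b)) = rotation_value J b"
proof (induction m)
  case 0
  show ?case using b by (simp add: frac_eq)
next
  case (Suc m)
  have irr: "frac (2 ^ k * b) \<in> {0..<1} - \<rat>" for k
    using b Rats_mult_nat_iff[of "2 ^ k" b] by (simp add: frac_lt_1 frac_in_Rats_iff)
  have "frac (2 * frac (2 ^ m * b)) = frac (2 ^ Suc m * b)"
    by (simp add: frac_double_frac mult.assoc)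
  from rotation_value_double[OF obs J irr irr this] show ?case using Suc by simp
qed

text \<open>Multiplication by 2^m sends \<open>b\<close> and its translate to the same angle, whose
  value both share.\<close>

lemma rotation_value_dyadic:
  assumes obs: "observes \<R> s J" and J: "isomorphism_invariant \<R> J" and b: "b \<in> {0..<1} - \<rat>"
  shows "rotation_value J (rotation (real j / 2 ^ m) b) = rotation_value J b"
proof -
  let ?b = "rotation (real j / 2 ^ m) b"
  have b': "?b \<in> {0..<1} - \<rat>"
  proof -
    have "b + real j / 2 ^ m \<notin> \<rat>"
    proof
      assume "b + real j / 2 ^ m \<in> \<rat>"
      then have "b + real j / 2 ^ m - real j / 2 ^ m \<in> \<rat>" by (intro Rats_diff Rats_divide) auto
      then show False using b by simp
    qed
    then show ?thesis by (simp add: rotation_def frac_in_Rats_iff frac_lt_1)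
  qed
  have "2 ^ m * ?b = 2 ^ m * b + of_int (int j - 2 ^ m * \<lfloor>b + real j / 2 ^ m\<rfloor>)"
    by (simp add: rotation_def frac_def algebra_simps)
  then have "frac (2 ^ m * ?b) = frac (2 ^ m * b)" by (metis Ints_of_int frac_add_int_right)
  then show ?thesis
    using rotation_value_frac_power2[OF obs J b, of m] rotation_value_frac_power2[OF obs J b', of m] by simp
qed

lemma dyadic_between:
  fixes c d :: real
  assumes "0 \<le> c" "c < d"
  obtains j m :: nat where "c < real j / 2 ^ m" "real j / 2 ^ m < d"
proof -
  obtain m where "(1/2) ^ m < d - c" using real_arch_pow_inv[of "d - c" "1/2"] assms by auto
  then have m: "1 < (d - c) * 2 ^ m" by (simp add: power_one_over divide_simps)
  define j where "j = Suc (nat \<lfloor>c * 2 ^ m\<rfloor>)"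
  have "c * 2 ^ m < real j" "real j \<le> c * 2 ^ m + 1" using assms by (auto simp: j_def) linarith+
  then have "c < real j / 2 ^ m" "real j / 2 ^ m < d"
    using m by (auto simp: pos_less_divide_eq pos_divide_less_eq algebra_simps)
  then show thesis by (rule that)
qed

section \<open>Measurable dependence on the angle\<close>

lemma measurable_orbit_name_pair:
  assumes [measurable]: "F \<in> sets borel" "A \<in> sets borel"
  shows "(\<lambda>z. orbit_name (fst z) F A n (snd z)) \<in> measurable (borel \<Otimes>\<^sub>M circle) (count_space UNIV)"
  unfolding orbit_name_def
proof (rule measurable_map_list, rule measurable_compose[OF _ measurable_cell_code[OF assms]])
  have [measurable]: "(\<lambda>x. x) \<in> measurable circle (borel :: real measure)"
    by (rule borel_measurable_circleI) simp
  have [measurable]: "snd \<in> borel_measurable (borel \<Otimes>\<^sub>M circle :: (real \<times> real) measure)"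
    by (rule measurable_compose[OF measurable_snd]) measurable
  show "(\<lambda>z. rotation (real i * fst z) (snd z)) \<in> borel_measurable (borel \<Otimes>\<^sub>M circle)" for i
    unfolding rotation_def by measurable
qed

text \<open>Truncation at 1 turns convergence in probability into convergence of means. The
  truncated distance from the value to \<open>p\<close> is thus a limit of functions measurable in
  the angle, although J itself carries no measurability.\<close>

lemma integral_orbit_name_tendsto:
  fixes J :: "process \<Rightarrow> 'd::metric_space"
  assumes obs: "observes \<R> s J" and J: "isomorphism_invariant \<R> J" and a: "a \<in> {0..<1} - \<rat>"
  shows "(\<lambda>n. \<integral>x. min 1 (dist (s (orbit_name a {0..<1/2} {} n x)) p) \<partial>circle)
    \<longlonglongrightarrow> min 1 (dist (rotation_value J a) p)"
proof (rule LIMSEQ_I)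
  fix e :: real assume e: "0 < e"
  let ?F = "{0..<1/2} :: real set"
  let ?c = "rotation_value J a"
  let ?far = "\<lambda>n. {x \<in> {0..<1}. dist (s (orbit_name a ?F {} n x)) ?c > e / 2}"
  have farm: "?far n \<in> sets circle" for n
    using measurable_orbit_name_set[OF half_circle_in_sets, of "{}" "\<lambda>l. dist (s l) ?c > e / 2" a n] by simp
  have "(\<lambda>n. measure circle (?far n)) \<longlonglongrightarrow> 0"
    by (rule observation_tendsto[OF obs J a half_circle_in_sets _ generates_half_circle[OF a]]) (use e in auto)
  then have "\<forall>\<^sub>F n in sequentially. measure circle (?far n) < e / 2"
    by (rule order_tendstoD) (use e in simp)
  then obtain m where m: "\<And>n. n \<ge> m \<Longrightarrow> measure circle (?far n) < e / 2"
    unfolding eventually_sequentially by blast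
  have "norm ((\<integral>x. min 1 (dist (s (orbit_name a ?F {} n x)) p) \<partial>circle) - min 1 (dist ?c p)) < e" if "n \<ge> m" for n
  proof -
    let ?g = "\<lambda>x. min 1 (dist (s (orbit_name a ?F {} n x)) p)"
    have gm: "?g \<in> borel_measurable circle"
      by (rule measurable_compose[OF measurable_orbit_name[OF half_circle_in_sets, of "{}" a n]]) auto
    have g: "integrable circle ?g"
      by (rule circle.integrable_const_bound[of _ 1]) (use gm in auto)
    have i: "integrable circle (\<lambda>x. e / 2 + indicator (?far n) x :: real)"
      using farm[of n] by (intro Bochner_Integration.integrable_add) (auto simp: integrable_real_indicator less_top[symmetric])
    have "norm ((\<integral>x. ?g x \<partial>circle) - min 1 (dist ?c p)) = norm (\<integral>x. ?g x - min 1 (dist ?c p) \<partial>circle)"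
      using g by (subst Bochner_Integration.integral_diff) (auto simp: circle.prob_space[simplified])
    also have "\<dots> \<le> (\<integral>x. norm (?g x - min 1 (dist ?c p)) \<partial>circle)" by (rule integral_norm_bound)
    \<comment> \<open>The truncated distances to \<open>p\<close> differ by at most e/2 off the far
      set and by at most 1 on it.\<close>
    also have "\<dots> \<le> (\<integral>x. e / 2 + indicator (?far n) x \<partial>circle)"
    proof (rule integral_mono[OF _ i])
      show "integrable circle (\<lambda>x. norm (?g x - min 1 (dist ?c p)))" using g by auto
      fix x assume x: "x \<in> space circle"
      let ?l = "s (orbit_name a ?F {} n x)"
      have t: "\<bar>dist ?l p - dist ?c p\<bar> \<le> dist ?l ?c" by (metis abs_dist_diff_le dist_commute)
      have "norm (min 1 (dist ?l p) - min 1 (dist ?c p)) \<le> min 1 (dist ?l ?c)"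
        using t zero_le_dist[of ?l p] zero_le_dist[of ?c p] unfolding real_norm_def by linarith
      then show "norm (?g x - min 1 (dist ?c p)) \<le> e / 2 + indicator (?far n) x"
        using e x by (cases "x \<in> ?far n") auto
    qed
    also have "\<dots> = e / 2 + measure circle (?far n)"
      using farm[of n] sets.Int_space_eq2[OF farm[of n]]
      by (subst Bochner_Integration.integral_add)
        (auto simp: circle.prob_space[simplified] integrable_real_indicator less_top[symmetric])
    also have "\<dots> < e" using m[OF that] by simp
    finally show ?thesis .
  qed
  then show "\<exists>m. \<forall>n\<ge>m. norm ((\<integral>x. min 1 (dist (s (orbit_name a ?F {} n x)) p) \<partial>circle) - min 1 (dist ?c p)) < e"
    by blast
qed

text \<open>A substitute for separability: every value of the invariant lies in the closure of the
  countable range of the scheme.\<close>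

lemma rotation_value_near_scheme:
  assumes obs: "observes \<R> s J" and J: "isomorphism_invariant \<R> J" and a: "a \<in> {0..<1} - \<rat>" and e: "0 < e"
  shows "\<exists>l. dist (s l) (rotation_value J a) \<le> e"
proof (rule ccontr)
  assume "\<nexists>l. dist (s l) (rotation_value J a) \<le> e"
  then have "{x \<in> {0..<1}. dist (s (orbit_name a {0..<1/2} {} n x)) (rotation_value J a) > e} = space circle" for n
    by (auto simp: not_le)
  moreover have "(\<lambda>n. measure circle {x \<in> {0..<1}. dist (s (orbit_name a {0..<1/2} {} n x)) (rotation_value J a) > e}) \<longlonglongrightarrow> 0"
    by (rule observation_tendsto[OF obs J a half_circle_in_sets _ generates_half_circle[OF a] e]) auto
  ultimately have "(\<lambda>n::nat. measure circle (space circle)) \<longlonglongrightarrow> 0" by simp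
  then show False by (simp only: circle.prob_space LIMSEQ_const_iff)
qed

lemma AE_circle_irrational: "AE x in circle. x \<notin> \<rat>"
proof (rule AE_I')
  have c: "countable (\<rat> \<inter> {0..<1} :: real set)" by (rule countable_subset[OF _ countable_rat]) auto
  then have "\<rat> \<inter> {0..<1} \<in> sets circle"
    by (auto simp: sets_circle_iff intro: sets.countable[of "\<rat> \<inter> {0..<1}" borel])
  moreover from this have "emeasure circle (\<rat> \<inter> {0..<1}) = 0"
    using c by (simp add: emeasure_circle emeasure_lborel_countable)
  ultimately show "\<rat> \<inter> {0..<1} \<in> null_sets circle" by auto
qed auto

text \<open>The sublevel set is measurable by the limit formula and invariant, up to null sets,
  under the dense set of dyadic rotations.\<close>

lemma rotation_value_sublevel_trivial:
  fixes J :: "process \<Rightarrow> 'd::metric_space"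
  assumes obs: "observes \<R> s J" and J: "isomorphism_invariant \<R> J"
    and E_def: "E = {a \<in> {0..<1} - \<rat>. min 1 (dist (rotation_value J a) p) < q}"
  shows "(AE a in circle. a \<in> E) \<or> (AE a in circle. a \<notin> E)"
proof -
  let ?I = "\<lambda>n a. \<integral>x. min 1 (dist (s (orbit_name a {0..<1/2} {} n x)) p) \<partial>circle"
  have I: "?I n \<in> borel_measurable borel" for n
  proof (rule circle.borel_measurable_lebesgue_integral)
    have "(\<lambda>z. min 1 (dist (s (orbit_name (fst z) {0..<1/2} {} n (snd z))) p)) \<in> borel_measurable (borel \<Otimes>\<^sub>M circle)"
      by (rule measurable_compose[OF measurable_orbit_name_pair]) auto
    then show "(\<lambda>(a, x). min 1 (dist (s (orbit_name a {0..<1/2} {} n x)) p)) \<in> borel_measurable (borel \<Otimes>\<^sub>M circle)"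
      by (simp add: case_prod_beta)
  qed
  have lim: "(\<lambda>a. lim (\<lambda>n. ?I n a)) \<in> borel_measurable borel"
    by (rule borel_measurable_lim_metric[OF I])
  have Q: "\<rat> \<in> sets (borel :: real measure)" by (rule sets.countable[OF _ countable_rat]) simp
  \<comment> \<open>The limit is identified only at irrational angles; elsewhere \<open>lim\<close>
    may be arbitrary, so those angles are cut out.\<close>
  have "E = {a \<in> {0..<1}. a \<notin> \<rat> \<and> lim (\<lambda>n. ?I n a) < q}"
    unfolding E_def
  proof (rule Collect_cong)
    fix a :: real
    show "a \<in> {0..<1} - \<rat> \<and> min 1 (dist (rotation_value J a) p) < q \<longleftrightarrow>
        a \<in> {0..<1} \<and> a \<notin> \<rat> \<and> lim (\<lambda>n. ?I n a) < q"
    proof (cases "a \<in> {0..<1} - \<rat>")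
      case True
      show ?thesis unfolding limI[OF integral_orbit_name_tendsto[OF obs J True, of p]] using True by simp
    next
      case False
      then show ?thesis by blast
    qed
  qed
  also have "\<dots> \<in> sets circle"
  proof (intro Collect_circle_in_sets pred_intros_logic pred_sets2[OF Q])
    show "Measurable.pred borel (\<lambda>a. lim (\<lambda>n. ?I n a) < q)"
      using borel_measurable_less[OF lim borel_measurable_const[of q]] by (simp only: pred_def)
  qed simp
  finally have E: "E \<in> sets circle" .
  have "measure circle E = 0 \<or> measure circle E = 1"
  proof (rule dense_rotation_invariant_trivial[OF E])
    fix c d :: real assume "0 \<le> c" "c < d" "d \<le> 1"
    then obtain j m :: nat where jm: "c < real j / 2 ^ m" "real j / 2 ^ m < d"
      using dyadic_between by blast
    have "AE x in circle. rotation (real j / 2 ^ m) x \<notin> \<rat>"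
      by (rule AE_comp_measure_preserving[OF measurable_rotation distr_rotation AE_circle_irrational])
    then have "AE x in circle. rotation (real j / 2 ^ m) x \<in> E \<longleftrightarrow> x \<in> E"
      using AE_circle_irrational AE_space
    proof eventually_elim
      case (elim x)
      then show ?case using rotation_value_dyadic[OF obs J, of x j m] by (simp add: E_def)
    qed
    then show "\<exists>s. c < s \<and> s < d \<and> (AE x in circle. rotation s x \<in> E \<longleftrightarrow> x \<in> E)"
      using jm by blast
  qed
  then show ?thesis
    using circle.prob_eq_0[OF E] circle.prob_eq_1[OF E] by blast
qed

text \<open>Almost every angle lies on the full side of every sublevel set with \<open>p\<close> in
  the range of the scheme and \<open>q\<close> rational. Two such angles have equal truncated
  distances to all values of the scheme, some of which come arbitrarily close to the first invariant
  value.\<close>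

lemma rotation_value_AE_constant:
  fixes J :: "process \<Rightarrow> 'd::metric_space"
  assumes obs: "observes \<R> s J" and J: "isomorphism_invariant \<R> J"
  obtains A where "A \<in> sets circle" "A \<subseteq> {0..<1} - \<rat>" "emeasure circle A = 1"
    "rotation_value J constant_on A"
proof -
  define E where "E p q = {a \<in> {0..<1} - \<rat>. min 1 (dist (rotation_value J a) p) < q}" for p q
  define full where "full p q \<longleftrightarrow> (AE a in circle. a \<in> E p q)" for p q
  have triv: "AE a in circle. a \<in> E p q \<longleftrightarrow> full p q" for p q
  proof (cases "full p q")
    case True
    then show ?thesis by (simp add: full_def)
  next
    case False
    then have "AE a in circle. a \<notin> E p q"
      using rotation_value_sublevel_trivial[OF obs J E_def, of p q] unfolding full_def by blast
    then show ?thesis using False by simp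
  qed
  have "countable (range s)" by simp
  then have "AE a in circle. \<forall>p\<in>range s. \<forall>q\<in>\<rat>. a \<in> E p q \<longleftrightarrow> full p q"
    by (subst AE_ball_countable, assumption, intro ballI, subst AE_ball_countable[OF countable_rat])
       (intro ballI triv)
  with AE_circle_irrational have ae: "AE a in circle. a \<notin> \<rat> \<and> (\<forall>p\<in>range s. \<forall>q\<in>\<rat>. a \<in> E p q \<longleftrightarrow> full p q)"
    by eventually_elim simp
  then obtain N where N: "{a \<in> space circle. \<not> (a \<notin> \<rat> \<and> (\<forall>p\<in>range s. \<forall>q\<in>\<rat>. a \<in> E p q \<longleftrightarrow> full p q))} \<subseteq> N"
    "emeasure circle N = 0" "N \<in> sets circle" by (rule AE_E)
  define A where "A = space circle - N"
  have A: "A \<in> sets circle" unfolding A_def by (rule sets.compl_sets[OF N(3)])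
  have AE: "a \<in> {0..<1} - \<rat> \<and> (\<forall>l. \<forall>q\<in>\<rat>. a \<in> E (s l) q \<longleftrightarrow> full (s l) q)" if "a \<in> A" for a
    using N(1) that unfolding A_def by auto
  have "emeasure circle A = emeasure circle (space circle) - emeasure circle N"
    unfolding A_def using N by (intro emeasure_compl) auto
  then have "emeasure circle A = 1" using N(2) circle.emeasure_space_1 by simp
  moreover have "rotation_value J a = rotation_value J b" if ab: "a \<in> A" "b \<in> A" for a b
  proof -
    have le: "min 1 (dist (rotation_value J b) (s l)) \<le> min 1 (dist (rotation_value J a) (s l))"
      if "a \<in> A" "b \<in> A" for a b l
    proof (rule ccontr)
      assume "\<not> ?thesis"
      then obtain q where q: "q \<in> \<rat>" "min 1 (dist (rotation_value J a) (s l)) < q"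
        "q < min 1 (dist (rotation_value J b) (s l))"
        using Rats_dense_in_real by (meson not_le)
      then have "a \<in> E (s l) q" "b \<notin> E (s l) q" using AE[OF that(1)] by (auto simp: E_def)
      then show False using AE[OF that(1)] AE[OF that(2)] q(1) by blast
    qed
    have "dist (rotation_value J a) (rotation_value J b) \<le> 0 + e" if "0 < e" for e
    proof -
      \<comment> \<open>As r < 1, a truncated distance of at most \<open>r\<close> bounds the true
        distance; r \<le> e/2 leaves room for the triangle inequality.\<close>
      define r where "r = min (1/2) (e / 2)"
      have r: "0 < r" "r < 1" "2 * r \<le> e" using that by (auto simp: r_def)
      obtain l where l: "dist (s l) (rotation_value J a) \<le> r"
        using rotation_value_near_scheme[OF obs J _ r(1)] AE[OF ab(1)] by blast
      then have "min 1 (dist (rotation_value J b) (s l)) \<le> r"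
        using le[OF ab, of l] by (simp add: dist_commute)
      then have "dist (rotation_value J b) (s l) \<le> r" using r by auto
      then show ?thesis
        using l r dist_triangle[of "rotation_value J a" "rotation_value J b" "s l"]
        by (simp add: dist_commute)
    qed
    then have "dist (rotation_value J a) (rotation_value J b) \<le> 0" by (rule field_le_epsilon)
    then show ?thesis by simp
  qed
  then have "rotation_value J constant_on A" unfolding constant_on_def by blast
  ultimately show thesis using A AE by (intro that[of A]) auto
qed

section \<open>Rotations by angles differing by a half turn\<close>

text \<open>The displacement \<Psi> x - x changes by 1/2 modulo 1 along the rotation by
  \<open>b\<close>; its character would be an eigenfunction with eigenvalue -1. In terms of sets,
  the points with displacement in a half circle would have measure 1/2 and be invariant under
  2b.\<close>

lemma half_turn_not_factor:
  assumes b: "b \<notin> \<rat>" and \<Psi>: "\<Psi> \<in> measurable circle circle"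
    and eqv: "AE x in circle. \<Psi> (rotation b x) = rotation (b + 1/2) (\<Psi> x)"
  shows False
proof -
  define E where "E = {x \<in> {0..<1}. frac (\<Psi> x - x) < 1/2}"
  have [measurable]: "\<Psi> \<in> borel_measurable circle" "(\<lambda>x. x) \<in> borel_measurable circle"
    using \<Psi> by (auto simp: measurable_circle_iff intro: borel_measurable_circleI)
  have "{x \<in> space circle. frac (\<Psi> x - x) < 1/2} \<in> sets circle" by measurable
  then have E: "E \<in> sets circle" by (simp add: E_def)
  have swap: "AE x in circle. rotation b x \<in> E \<longleftrightarrow> x \<notin> E"
    using eqv AE_space
  proof eventually_elim
    case (elim x)
    let ?u = "\<Psi> x - x"
    have "\<Psi> (rotation b x) - rotation b x = ?u + 1/2 + of_int (\<lfloor>x + b\<rfloor> - \<lfloor>\<Psi> x + (b + 1/2)\<rfloor>)"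
      using elim(1) by (simp add: rotation_def frac_def)
    then have "frac (\<Psi> (rotation b x) - rotation b x) = frac (?u + 1/2)"
      by (metis Ints_of_int frac_add_int_right)
    also have "\<dots> = frac (frac ?u + 1/2)" by (simp add: frac_add_frac)
    finally have turn: "frac (\<Psi> (rotation b x) - rotation b x) = frac (frac ?u + 1/2)" .
    have "frac (frac ?u + 1/2) < 1/2 \<longleftrightarrow> \<not> frac ?u < 1/2"
    proof (cases "frac ?u < 1/2")
      case True
      then have "frac (frac ?u + 1/2) = frac ?u + 1/2" by (subst frac_eq) auto
      then show ?thesis using True frac_ge_0[of ?u] by linarith
    next
      case False
      have shift: "frac ?u + 1/2 = (frac ?u - 1/2) + 1" by simp
      have "frac (frac ?u + 1/2) = frac (frac ?u - 1/2)" unfolding shift by (rule frac_1_eq)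
      also have "\<dots> = frac ?u - 1/2"
        unfolding frac_eq using False frac_lt_1[of ?u] by (intro conjI) linarith+
      finally show ?thesis using False frac_lt_1[of ?u] by simp
    qed
    moreover have "x \<in> {0..<1}" "rotation b x \<in> {0..<1}" using elim(2) by auto
    ultimately show ?case unfolding E_def mem_Collect_eq turn by blast
  qed
  have "AE x in circle. rotation b (rotation b x) \<in> E \<longleftrightarrow> rotation b x \<notin> E"
    by (rule AE_comp_measure_preserving[OF measurable_rotation distr_rotation swap])
  with swap have "AE x in circle. rotation (2 * b) x \<in> E \<longleftrightarrow> x \<in> E"
  proof eventually_elim
    case (elim x)
    then show ?case unfolding rotation_rotation mult_2 by blast
  qed
  moreover have "2 * b \<notin> \<rat>" using b Rats_mult_nat_iff[of 2 b] by simp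
  ultimately have "measure circle E = 0 \<or> measure circle E = 1"
    using rotation_invariant_trivial E by blast
  moreover have "measure circle E = measure circle {x \<in> {0..<1}. rotation b x \<in> E}"
    by (rule measure_rotation_vimage[OF E, symmetric])
  moreover have "\<dots> = measure circle (space circle - E)"
  proof (rule circle.finite_measure_eq_AE)
    show "AE x in circle. x \<in> {x \<in> {0..<1}. rotation b x \<in> E} \<longleftrightarrow> x \<in> space circle - E"
      using swap AE_space by eventually_elim simp
  qed (rule rotation_vimage_in_sets[OF E], rule sets.compl_sets[OF E])
  moreover have "\<dots> = 1 - measure circle E" by (rule circle.prob_compl[OF E])
  ultimately show False by linarith
qed

text \<open>The angles b and b + 1/2 differ by a dyadic translation, so their values agree; taking b
  below 1/2 avoids wrap-around.\<close>

lemma finitely_observable_not_complete: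
  assumes obs: "observes \<R> s J" and complete: "complete_invariant \<R> J"
  shows False
proof -
  have J: "isomorphism_invariant \<R> J" using complete by (simp add: complete_invariant_def)
  have "\<not> {0..<1/2 :: real} \<subseteq> \<rat>"
    using countable_subset[OF _ countable_rat] uncountable_half_open_interval_1[of 0 "1/2"] by auto
  then obtain b :: real where "b \<in> {0..<1/2}" "b \<notin> \<rat>" by blast
  then have b: "0 \<le> b" "b < 1/2" "b \<notin> \<rat>" by auto
  let ?b = "b + 1/2"
  have b1: "b \<in> {0..<1} - \<rat>" using b by auto
  have "rotation (real 1 / 2 ^ 1) b = ?b" using b by (simp add: rotation_eq_add)
  then have eq: "rotation_value J ?b = rotation_value J b"
    using rotation_value_dyadic[OF obs J b1, of 1 1] by simp
  have b2: "?b \<in> {0..<1} - \<rat>"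
    using b Rats_diff[of ?b "1/2"] by auto
  let ?P = "cells {0..<1/2} {}"
  have P: "finite_partition circle ?P" by (rule finite_partition_cells[OF half_circle_in_sets]) simp
  have gen: "generates circle (rotation b) ?P" "generates circle (rotation ?b) ?P"
    using generates_half_circle[OF b1] generates_half_circle[OF b2] by auto
  have "J (process_law circle (rotation b) ?P) = J (process_law circle (rotation ?b) ?P)"
    using J_process_law[OF J b1 P gen(1)] J_process_law[OF J b2 P gen(2)] eq by simp
  then have "process_law circle (rotation b) ?P \<cong>\<^sub>p process_law circle (rotation ?b) ?P"
    using complete process_law_in_rotation_processes[OF b1 P gen(1)]
      process_law_in_rotation_processes[OF b2 P gen(2)]
    unfolding complete_invariant_def by blast
  then obtain \<Psi> where "\<Psi> \<in> measurable circle circle"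
    "AE x in circle. \<Psi> (rotation b x) = rotation ?b (\<Psi> x)"
    using isomorphic_rotation_processes_factor[OF _ P _ P gen(2)] b1 b2 by blast
  then show False using half_turn_not_factor[OF b(3)] by blast
qed

text \<open>The first conjunct certifies that \<open>rotation_value\<close> is the actual common
  value of J on all processes of the rotation, and not an unspecified result of
  \<open>THE\<close>.\<close>

theorem theorem4p6:
  fixes J :: "process \<Rightarrow> 'd::metric_space"
  assumes "finitely_observable \<R> J"
    and "isomorphism_invariant \<R> J"
  shows "(\<forall>\<alpha>\<in>{0..<1} - \<rat>. J ` processes_of circle (rotation \<alpha>) = {rotation_value J \<alpha>}) \<and>
         (\<exists>A\<in>sets lebesgue. A \<subseteq> {0..<1} - \<rat> \<and> emeasure lebesgue A = 1 \<and>
            rotation_value J constant_on A) \<and>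
         \<not> complete_invariant \<R> J"
proof (intro conjI ballI notI)
  obtain s where obs: "observes \<R> s J" using assms(1) by (auto simp: finitely_observable_def)
  show "J ` processes_of circle (rotation \<alpha>) = {rotation_value J \<alpha>}" if "\<alpha> \<in> {0..<1} - \<rat>" for \<alpha>
    by (rule rotation_value_image[OF assms(2) that])
  obtain A where A: "A \<in> sets circle" "A \<subseteq> {0..<1} - \<rat>" "emeasure circle A = 1"
    "rotation_value J constant_on A"
    by (rule rotation_value_AE_constant[OF obs assms(2)])
  then have "A \<in> sets lborel" "emeasure lebesgue A = 1"
    by (auto simp: sets_circle_iff emeasure_circle)
  then show "\<exists>A\<in>sets lebesgue. A \<subseteq> {0..<1} - \<rat> \<and> emeasure lebesgue A = 1 \<and> rotation_value J constant_on A"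
    using A by (intro bexI[of _ A]) auto
  show False if "complete_invariant \<R> J"
    by (rule finitely_observable_not_complete[OF obs that])
qed

end
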